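(* Let $X=X_\Sigma$ be the $n$-dimensional toric variety of a complete fan $\Sigma$ in $\mathbb{R}^n$ with $k$ rays, and let $f=\sum_\ell f_\ell x^\ell$, $g=\sum_\ell g_\ell x^\ell$ in $S=\mathbb{C}[x_1,\dots,x_k]$ be nonzero homogeneous polynomials with positive coefficients and the same degree in $\mathrm{Cl}(X)$, with $\dim\mathcal{N}(g)=n$ and $\mathcal{N}(f)$ contained in the relative interior of $\mathcal{N}(g)$. Let $h=\frac{f\cdot g^{\rm tr}}{g\cdot f^{\rm tr}}$ on $X_{>0}$ and $M_2=\dfrac{\sum_{\ell\in\mathrm{supp}(f)}f_\ell}{\min_{\ell\in\mathrm{supp}(g)}g_\ell}$. Consider the following procedure. 1. Draw $x\in X_{>0}$ from the probability measure $\mu^{\rm tr}_{f,g}=\frac{1}{\mathcal{I}^{\rm tr}}\frac{f^{\rm tr}}{g^{\rm tr}}\Omega_X$. 2. Draw $\xi$ uniformly from the interval $[0,M_2]$ (independently of $x$). 3. If $\xi<h(x)$, output $x$. Otherwise reject the sample and start again (with fresh independent draws). Then the output is a sample from the probability space $(X_{>0},\mu_{f,g})$, i.e. its distribution is $\mu_{f,g}=\frac{1}{\mathcal{I}}\frac{f}{g}\,\Omega_X$, where $\mathcal{I}=\int_{X_{>0}}\frac{f}{g}\Omega_X$.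
   Context: Let $\Sigma$ be a complete rational polyhedral fan in $\mathbb{R}^n$ with primitive ray generators $v_1,\dots,v_k\in\mathbb{Z}^n$, and $V=[v_1\,\cdots\,v_k]\in\mathbb{Z}^{n\times k}$. Let $X=X_\Sigma$ be the associated toric variety with dense torus $T=(\mathbb{C}^* )^n$ (coordinates $t_j$). The Cox ring $S=\mathbb{C}[x_1,\dots,x_k]$ is graded by $\mathrm{Cl}(X)=\mathbb{Z}^k/\mathrm{im}(V^\top)$ with $\deg x_i$ the class of the $i$-th unit vector. The Cox quotient map $\pi$ is given on $(\mathbb{C}^* )^k$ by $x\mapsto(\prod_i x_i^{(v_i)_j})_{j=1,\dots,n}\in T$, and $X_{>0}=\pi(\mathbb{R}^k_{>0})\simeq\mathbb{R}^n_{>0}$. The canonical form is $\Omega_X=\sum_{|I|=n}\det(V_I)\bigwedge_{i\in I}\frac{\mathrm{d}x_i}{x_i}$; it is the pullback under $\pi$ of $\bigwedge_{j=1}^n\mathrm{d}t_j/t_j$, is viewed as a form on $X$, and $X_{>0}$ is oriented so that it is positive. For a polynomial $f$ with positive coefficients, $\mathrm{supp}(f)$ is its set of exponent vectors, $\mathcal{N}(f)\subset\mathbb{R}^k$ its Newton polytope, and $f^{\rm tr}(x)=\max_{\ell\in\mathrm{supp}(f)}x^\ell$ for $x\in\mathbb{R}^k_{>0}$. The functions $f/g$, $f^{\rm tr}/g^{\rm tr}$ and $h$ are constant on the fibres of $\pi:\mathbb{R}^k_{>0}\to X_{>0}$ and are viewed as functions on $X_{>0}$. $\mathcal{I}^{\rm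 tr}=\int_{X_{>0}}\frac{f^{\rm tr}}{g^{\rm tr}}\Omega_X$. Under the stated hypotheses both $\mathcal{I}$ and $\mathcal{I}^{\rm tr}$ are finite and positive. *)

theory Defs
  imports "HOL-Probability.Probability" "HOL-Library.Poly_Mapping"
begin

section \<open>Complete rational polyhedral fans\<close>

definition real_vec :: "int ^ 'n \<Rightarrow> real ^ 'n" where
  "real_vec u = (\<chi> j. real_of_int (u $ j))"

definition strongly_convex_rational_cone :: "(real ^ 'n) set \<Rightarrow> bool" where
  "strongly_convex_rational_cone \<sigma> \<longleftrightarrow>
     (\<exists>S :: (int ^ 'n) set. finite S \<and> \<sigma> = convex_cone hull (real_vec ` S)) \<and>
     \<sigma> \<inter> uminus ` \<sigma> = {0}"

text \<open>The library's \<open>face_of\<close> counts the empty set as a face; cones have only nonempty faces.\<close>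

definition rational_fan :: "(real ^ 'n) set set \<Rightarrow> bool" where
  "rational_fan \<Sigma> \<longleftrightarrow>
     finite \<Sigma> \<and>
     (\<forall>\<sigma>\<in>\<Sigma>. strongly_convex_rational_cone \<sigma>) \<and>
     (\<forall>\<sigma>\<in>\<Sigma>. \<forall>\<tau>. \<tau> face_of \<sigma> \<and> \<tau> \<noteq> {} \<longrightarrow> \<tau> \<in> \<Sigma>) \<and>
     (\<forall>\<sigma>\<in>\<Sigma>. \<forall>\<tau>\<in>\<Sigma>. \<sigma> \<inter> \<tau> face_of \<sigma> \<and> \<sigma> \<inter> \<tau> face_of \<tau>)"

definition complete_rational_fan :: "(real ^ 'n) set set \<Rightarrow> bool" where
  "complete_rational_fan \<Sigma> \<longleftrightarrow> rational_fan \<Sigma> \<and> \<Union>\<Sigma> = UNIV"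

definition primitive_ray_generators :: "(real ^ 'n) set set \<Rightarrow> (int ^ 'n) set" where
  "primitive_ray_generators \<Sigma> =
     {u. Gcd (range (\<lambda>j. u $ j)) = 1 \<and>
         (\<exists>\<rho>\<in>\<Sigma>. aff_dim \<rho> = 1 \<and> \<rho> = conic hull {real_vec u})}"

definition ray_matrix :: "(real ^ 'n) set set \<Rightarrow> int ^ 'k ^ 'n \<Rightarrow> bool" where
  "ray_matrix \<Sigma> V \<longleftrightarrow> bij_betw (\<lambda>i. column i V) UNIV (primitive_ray_generators \<Sigma>)"

section \<open>The Cox ring and its grading\<close>

text \<open>An element of the Cox ring is a finitely supported map from exponents to coefficients.\<close>

type_synonym 'k cox_ring = "('k \<Rightarrow>\<^sub>0 nat) \<Rightarrow>\<^sub>0 complex"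

definition linear_equivalence :: "int ^ 'k ^ 'n \<Rightarrow> ((int ^ 'k) \<times> (int ^ 'k)) set" where
  "linear_equivalence V = {(a, b). a - b \<in> range (\<lambda>m. transpose V *v m)}"

definition class_group :: "int ^ 'k ^ 'n \<Rightarrow> (int ^ 'k) set set" where
  "class_group V = UNIV // linear_equivalence V"

definition monomial_degree :: "int ^ 'k ^ 'n \<Rightarrow> ('k \<Rightarrow>\<^sub>0 nat) \<Rightarrow> (int ^ 'k) set" where
  "monomial_degree V l = linear_equivalence V `` {\<chi> i. int (Poly_Mapping.lookup l i)}"

definition homogeneous :: "int ^ 'k ^ 'n \<Rightarrow> (int ^ 'k) set \<Rightarrow> 'k cox_ring \<Rightarrow> bool" where
  "homogeneous V \<alpha> f \<longleftrightarrow> (\<forall>l\<in>Poly_Mapping.keys f. monomial_degree V l = \<alpha>)"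

definition positive_coefficients :: "'k cox_ring \<Rightarrow> bool" where
  "positive_coefficients f \<longleftrightarrow> (\<forall>l\<in>Poly_Mapping.keys f. Poly_Mapping.lookup f l \<in> \<real> \<and> 0 < Re (Poly_Mapping.lookup f l))"

definition newton_polytope :: "'k::finite cox_ring \<Rightarrow> (real ^ 'k) set" where
  "newton_polytope f = convex hull ((\<lambda>l. \<chi> i. real (Poly_Mapping.lookup l i)) ` Poly_Mapping.keys f)"

definition monomial_fun :: "('k::finite \<Rightarrow>\<^sub>0 nat) \<Rightarrow> 'a::comm_ring_1 ^ 'k \<Rightarrow> 'a" where
  "monomial_fun l x = (\<Prod>i\<in>UNIV. (x $ i) ^ Poly_Mapping.lookup l i)"

definition cox_eval :: "'k::finite cox_ring \<Rightarrow> complex ^ 'k \<Rightarrow> complex" where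
  "cox_eval f x = (\<Sum>l\<in>Poly_Mapping.keys f. Poly_Mapping.lookup f l * monomial_fun l x)"

text \<open>The value at a real point; \<open>Re\<close> loses nothing when the coefficients are positive.\<close>

definition poly_fun :: "'k::finite cox_ring \<Rightarrow> real ^ 'k \<Rightarrow> real" where
  "poly_fun f x = Re (cox_eval f (\<chi> i. complex_of_real (x $ i)))"

definition trop_fun :: "'k::finite cox_ring \<Rightarrow> real ^ 'k \<Rightarrow> real" where
  "trop_fun f x = Max ((\<lambda>l. monomial_fun l x) ` Poly_Mapping.keys f)"

section \<open>The positive part of the toric variety\<close>

text \<open>The positive part lies in the dense torus and is described in the coordinates \<open>t\<^sub>j\<close>.\<close>

definition cox_quotient :: "int ^ 'k ^ 'n \<Rightarrow> real ^ 'k \<Rightarrow> real ^ 'n" where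
  "cox_quotient V x = (\<chi> j. \<Prod>i\<in>UNIV. (x $ i) powi (V $ j $ i))"

definition positive_orthant :: "(real ^ 'k) set" where
  "positive_orthant = {x. \<forall>i. 0 < x $ i}"

definition positive_part :: "int ^ 'k ^ 'n \<Rightarrow> (real ^ 'n) set" where
  "positive_part V = cox_quotient V ` positive_orthant"

text \<open>A function that is constant on the fibres of \<open>cox_quotient V\<close>, viewed on the positive part.\<close>

definition descend :: "int ^ 'k ^ 'n \<Rightarrow> (real ^ 'k \<Rightarrow> real) \<Rightarrow> real ^ 'n \<Rightarrow> real" where
  "descend V F t = (THE y. \<exists>x\<in>positive_orthant. cox_quotient V x = t \<and> F x = y)"

text \<open>
  The canonical form at \<open>x\<close>, evaluated on the tangent vectors \<open>w j\<close>.  An index set \<open>I\<close> of size \<open>n\<close>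
  is given by its increasing enumeration \<open>e\<close>, and the wedge product of the \<open>dx\<^sub>i / x\<^sub>i\<close>
  for \<open>i \<in> I\<close> takes the value \<open>det (dx\<^sub>i (w j) / x\<^sub>i)\<close>.
\<close>

definition canonical_form ::
  "int ^ 'k::{finite,linorder} ^ 'n::{finite,linorder} \<Rightarrow>
   real ^ 'k::{finite,linorder} \<Rightarrow>
   ('n \<Rightarrow> real ^ 'k::{finite,linorder}) \<Rightarrow> real" where
  "canonical_form V x w =
     (\<Sum>e | strict_mono (e :: 'n \<Rightarrow> 'k).
        real_of_int (det (\<chi> j m. V $ j $ e m)) * det (\<chi> m j. w j $ e m / x $ e m))"

text \<open>
  The form on the positive part whose pullback under \<open>cox_quotient V\<close> is the canonical form: its
  value on tangent vectors at \<open>t\<close> is computed on any lifts of them to a point of the fibre.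
\<close>

definition canonical_form_on_X ::
  "int ^ 'k::{finite,linorder} ^ 'n::{finite,linorder} \<Rightarrow>
   real ^ 'n::{finite,linorder} \<Rightarrow>
   ('n \<Rightarrow> real ^ 'n::{finite,linorder}) \<Rightarrow> real" where
  "canonical_form_on_X V t w =
     (THE y. \<exists>x\<in>positive_orthant. \<exists>w'. cox_quotient V x = t \<and>
        (\<forall>j. frechet_derivative (cox_quotient V) (at x) (w' j) = w j) \<and>
        canonical_form V x w' = y)"

text \<open>Integration of the form, for the orientation that makes it positive.\<close>

definition canonical_measure ::
  "int ^ 'k::{finite,linorder} ^ 'n::{finite,linorder} \<Rightarrow> (real ^ 'n::{finite,linorder}) measure" where
  "canonical_measure V =
     density (restrict_space lborel (positive_part V))
       (\<lambda>t. ennreal \<bar>canonical_form_on_X V t (\<lambda>j. axis j 1)\<bar>)"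

definition normalized_measure :: "'a measure \<Rightarrow> ('a \<Rightarrow> real) \<Rightarrow> 'a measure" where
  "normalized_measure M F = density M (\<lambda>t. ennreal (1 / integral\<^sup>L M F * F t))"

definition mu ::
  "int ^ 'k::{finite,linorder} ^ 'n::{finite,linorder} \<Rightarrow> 'k cox_ring \<Rightarrow> 'k cox_ring \<Rightarrow>
   (real ^ 'n::{finite,linorder}) measure" where
  "mu V f g = normalized_measure (canonical_measure V)
     (descend V (\<lambda>x. poly_fun f x / poly_fun g x))"

definition mu_tr ::
  "int ^ 'k::{finite,linorder} ^ 'n::{finite,linorder} \<Rightarrow> 'k cox_ring \<Rightarrow> 'k cox_ring \<Rightarrow>
   (real ^ 'n::{finite,linorder}) measure" where
  "mu_tr V f g = normalized_measure (canonical_measure V)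
     (descend V (\<lambda>x. trop_fun f x / trop_fun g x))"

section \<open>Rejection sampling\<close>

definition ratio_h :: "int ^ 'k ^ 'n \<Rightarrow> 'k cox_ring \<Rightarrow> 'k cox_ring \<Rightarrow> real ^ 'n \<Rightarrow> real" where
  "ratio_h V f g =
     descend V (\<lambda>x. poly_fun f x * trop_fun g x / (poly_fun g x * trop_fun f x))"

definition M2 :: "'k cox_ring \<Rightarrow> 'k cox_ring \<Rightarrow> real" where
  "M2 f g = (\<Sum>l\<in>Poly_Mapping.keys f. Re (Poly_Mapping.lookup f l)) / Min ((\<lambda>l. Re (Poly_Mapping.lookup g l)) ` Poly_Mapping.keys g)"

text \<open>
  \<open>X i\<close> and \<open>\<xi> i\<close> are the two draws of round \<open>i\<close>, on a common probability space \<open>P\<close>.  That their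
  joint law is a product says that they have the given laws and are independent of each other
  (the library's \<open>indep_var\<close> needs both variables to take values in the same type).
\<close>

definition rejection_draws ::
  "'w measure \<Rightarrow> 'a measure \<Rightarrow> real \<Rightarrow> (nat \<Rightarrow> 'w \<Rightarrow> 'a) \<Rightarrow> (nat \<Rightarrow> 'w \<Rightarrow> real) \<Rightarrow> bool" where
  "rejection_draws P \<mu> M X \<xi> \<longleftrightarrow>
     prob_space P \<and>
     (\<forall>i. distr P (\<mu> \<Otimes>\<^sub>M borel) (\<lambda>\<omega>. (X i \<omega>, \<xi> i \<omega>)) = \<mu> \<Otimes>\<^sub>M uniform_measure lborel {0..M}) \<and>
     prob_space.indep_vars P (\<lambda>_. \<mu> \<Otimes>\<^sub>M borel) (\<lambda>i \<omega>. (X i \<omega>, \<xi> i \<omega>)) UNIV"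

definition accepted ::
  "('a \<Rightarrow> real) \<Rightarrow> (nat \<Rightarrow> 'w \<Rightarrow> 'a) \<Rightarrow> (nat \<Rightarrow> 'w \<Rightarrow> real) \<Rightarrow> nat \<Rightarrow> 'w \<Rightarrow> bool" where
  "accepted h X \<xi> i \<omega> \<longleftrightarrow> \<xi> i \<omega> < h (X i \<omega>)"

text \<open>The value is only meaningful when some round is accepted.\<close>

definition rejection_output ::
  "('a \<Rightarrow> real) \<Rightarrow> (nat \<Rightarrow> 'w \<Rightarrow> 'a) \<Rightarrow> (nat \<Rightarrow> 'w \<Rightarrow> real) \<Rightarrow> 'w \<Rightarrow> 'a" where
  "rejection_output h X \<xi> \<omega> = X (LEAST i. accepted h X \<xi> i \<omega>) \<omega>"

end

theory Submission
  imports Defs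
begin

text \<open>
  In logarithmic coordinates everything is linear. Writing \<open>x = exp u\<close>, the Cox quotient is
  \<open>u \<mapsto> V u = ln t\<close> and the monomial with exponent \<open>l\<close> is
  \<open>exp (u \<bullet> l)\<close>. Since \<open>f\<close> and \<open>g\<close> have the same degree,
  all their exponents lie in one translate of the image of the transpose of \<open>V\<close>. Hence all
  their monomials change by the same factor along a fibre of the quotient, and the ratios of
  \<open>f\<close>, \<open>g\<close> and their tropical versions descend
  (\<open>fibre_constant_ratios\<close>). The condition that the Newton polytope of \<open>g\<close> has
  dimension \<open>n\<close> forces \<open>V\<close> to have rank \<open>n\<close>
  (\<open>affine_hull_newton_polytope\<close>), so the positive part is the whole positive orthant. The
  formula of Cauchy and Binet identifies the canonical form there with
  \<open>\<And>\<^sub>j dt\<^sub>j / t\<^sub>j\<close> (\<open>canonical_form_eq_det\<close>,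
  \<open>canonical_measure_eq\<close>).

  Finiteness of the two integrals comes from the position of the polytopes. The exponents of
  \<open>f\<close> can be moved by a fixed amount in every direction of the affine hull of the Newton
  polytope of \<open>g\<close> without leaving this polytope, so the tropical ratio is at most \<open>exp (- \<epsilon> \<parallel>ln t\<parallel>\<^sub>1)\<close> for some
  \<open>\<epsilon> > 0\<close> (\<open>trop_decay\<close>). This is integrable against the canonical
  form. The ratio \<open>f / g\<close> is the tropical ratio times \<open>h\<close>, and
  \<open>0 < h \<le> M\<^sub>2\<close> (\<open>poly_ratio_le\<close>), so it is integrable as well.

  What remains is the general principle of rejection sampling, proved for any probability measure
  \<open>\<mu>\<close> and any measurable \<open>h\<close> with \<open>0 < h \<le> M\<close>. One round
  accepts with a value in \<open>B\<close> with probability \<open>1/M\<close> times the integral of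
  \<open>h\<close> over \<open>B\<close>; summing the geometric series over the round of the first
  acceptance shows that some round accepts almost surely and that the output has density
  proportional to \<open>h\<close> with respect to \<open>\<mu>\<close>
  (\<open>distr_rejection_output\<close>). For \<open>\<mu>\<close> the normalised tropical ratio, the
  product with \<open>h\<close> is the normalised \<open>f / g\<close>.
\<close>

section \<open>The Cauchy-Binet formula\<close>

text \<open>The value at \<open>n\<close> is the element of the range that has as many elements of the
  range below it as \<open>n\<close> has predecessors.\<close>

lemma strict_mono_eq_if_range_eq:
  fixes e e' :: "'n::{finite,linorder} \<Rightarrow> 'k::linorder"
  assumes "strict_mono e" "strict_mono e'" "range e = range e'"
  shows "e = e'"
proof
  fix n
  have below: "range d \<inter> {..<d n} = d ` {..<n}" if "strict_mono d" for d :: "'n \<Rightarrow> 'k"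
    using strict_mono_less[OF that] by auto
  have card_below: "card (range d \<inter> {..<d n}) = card {..<n}" if "strict_mono d" for d :: "'n \<Rightarrow> 'k"
    unfolding below[OF that] by (intro card_image strict_mono_imp_inj_on that)
  have "\<not> d n < d' n"
    if "strict_mono d" "strict_mono d'" "range d = range d'" for d d' :: "'n \<Rightarrow> 'k"
  proof
    assume "d n < d' n"
    then have "range d \<inter> {..<d n} \<subset> range d' \<inter> {..<d' n}"
      using that(3) by auto
    then have "card (range d \<inter> {..<d n}) < card (range d' \<inter> {..<d' n})"
      by (intro psubset_card_mono) auto
    then show False
      unfolding card_below[OF that(1)] card_below[OF that(2)] by simp
  qed
  then show "e n = e' n"
    using assms by (metis linorder_neqE)
qed

lemma strict_mono_enumeration:
  fixes S :: "'k::linorder set"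
  assumes "card S = CARD('n)"
  obtains e :: "'n::{finite,linorder} \<Rightarrow> 'k" where "strict_mono e" "range e = S"
proof -
  define e where "e n = sorted_list_of_set S ! card {..<n}" for n :: 'n
  have fin: "finite S"
    using assms by (intro card_ge_0_finite) simp
  have len: "length (sorted_list_of_set S) = CARD('n)"
    using assms by simp
  have rank_less: "card {..<n} < CARD('n)" for n :: 'n
    by (intro psubset_card_mono) auto
  have "e m < e n" if "m < n" for m n
  proof -
    have "card {..<m} < card {..<n}"
      using that by (intro psubset_card_mono) auto
    then show ?thesis
      unfolding e_def using rank_less len
      by (metis sorted_wrt_nth_less strict_sorted_list_of_set)
  qed
  then have mono: "strict_mono e"
    by (simp add: strict_mono_def)
  have "e n \<in> set (sorted_list_of_set S)" for n
    unfolding e_def by (rule nth_mem) (simp only: len rank_less)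
  then have "range e \<subseteq> S"
    using fin by auto
  moreover have "card (range e) = card S"
    using mono assms by (simp add: card_image strict_mono_imp_inj_on)
  ultimately have "range e = S"
    using fin by (metis card_subset_eq)
  with mono show ?thesis ..
qed

text \<open>This is what groups the expansion of a determinant of a product into minors: an
  injective choice of columns amounts to a set of columns, listed increasingly, and an ordering of it.\<close>

lemma bij_betw_strict_mono_permutes_inj:
  "bij_betw (\<lambda>(e, p). e \<circ> p)
     ({e :: 'n::{finite,linorder} \<Rightarrow> 'k::linorder. strict_mono e} \<times> {p. p permutes UNIV})
     {\<phi>. inj \<phi>}"
  unfolding bij_betw_def
proof
  show "inj_on (\<lambda>(e, p). e \<circ> p)
     ({e :: 'n \<Rightarrow> 'k. strict_mono e} \<times> {p. p permutes UNIV})"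
  proof (intro inj_onI, clarify)
    fix e e' :: "'n \<Rightarrow> 'k" and p p' :: "'n \<Rightarrow> 'n"
    assume *: "strict_mono e" "strict_mono e'" "p permutes UNIV" "p' permutes UNIV"
      and eq: "e \<circ> p = e' \<circ> p'"
    have "range (e \<circ> p) = range e" "range (e' \<circ> p') = range e'"
      using *(3,4) by (metis image_comp permutes_surj)+
    with eq have "e = e'"
      using * by (intro strict_mono_eq_if_range_eq) auto
    moreover from this have "p = p'"
      using eq strict_mono_imp_inj_on[OF *(2)] by (auto simp: fun_eq_iff inj_eq)
    ultimately show "e = e' \<and> p = p'" ..
  qed
  show "(\<lambda>(e, p). e \<circ> p) `
     ({e :: 'n \<Rightarrow> 'k. strict_mono e} \<times> {p. p permutes UNIV}) = {\<phi>. inj \<phi>}"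
  proof (intro equalityI subsetI)
    fix \<phi> :: "'n \<Rightarrow> 'k"
    assume "\<phi> \<in> {\<phi>. inj \<phi>}"
    then have inj: "inj \<phi>" by simp
    then have "card (range \<phi>) = CARD('n)"
      by (simp add: card_image)
    then obtain e :: "'n \<Rightarrow> 'k" where e: "strict_mono e" "range e = range \<phi>"
      by (rule strict_mono_enumeration)
    define p where "p = inv e \<circ> \<phi>"
    have "e \<circ> p = \<phi>"
      using e(2) by (auto simp: p_def fun_eq_iff f_inv_into_f)
    moreover from this have "inj p"
      using inj by (metis inj_on_imageI2)
    then have "p permutes UNIV"
      by (intro bij_imp_permutes) (auto simp: bij_def finite_UNIV_inj_surj)
    ultimately show "\<phi> \<in> (\<lambda>(e, p). e \<circ> p) ` ({e. strict_mono e} \<times> {p. p permutes UNIV})"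
      using e(1) by (force intro: image_eqI[where x = "(e, p)"])
  next
    fix \<phi> :: "'n \<Rightarrow> 'k"
    assume "\<phi> \<in> (\<lambda>(e, p). e \<circ> p) ` ({e. strict_mono e} \<times> {p. p permutes UNIV})"
    then obtain e :: "'n \<Rightarrow> 'k" and p where "strict_mono e" "p permutes UNIV" "\<phi> = e \<circ> p"
      by auto
    then show "\<phi> \<in> {\<phi>. inj \<phi>}"
      using inj_compose[OF strict_mono_imp_inj_on permutes_inj] by simp
  qed
qed

text \<open>Each row is expanded independently of the others, so the sum runs over all choices
  of one summand per row.\<close>

lemma det_rows_sum:
  fixes a :: "'n::finite \<Rightarrow> 'k::finite \<Rightarrow> 'a::comm_ring_1 ^ 'n"
  shows "det (\<chi> i. \<Sum>k\<in>UNIV. a i k) = (\<Sum>\<phi>\<in>UNIV. det (\<chi> i. a i (\<phi> i)))"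
proof -
  have "(\<Prod>i\<in>UNIV. \<Sum>k\<in>UNIV. a i k $ p i) = (\<Sum>\<phi>\<in>UNIV. \<Prod>i\<in>UNIV. a i (\<phi> i) $ p i)" for p
  proof -
    have "(\<Pi>\<^sub>E i\<in>(UNIV :: 'n set). UNIV :: 'k set) = UNIV"
      by auto
    then show ?thesis
      using prod_sum_PiE[of "UNIV :: 'n set" "\<lambda>_. UNIV" "\<lambda>i k. a i k $ p i"] by simp
  qed
  then have "det (\<chi> i. \<Sum>k\<in>UNIV. a i k) =
      (\<Sum>p | p permutes (UNIV :: 'n set). \<Sum>\<phi>\<in>UNIV. of_int (sign p) * (\<Prod>i\<in>UNIV. a i (\<phi> i) $ p i))"
    by (simp add: det_def sum_distrib_left)
  also have "\<dots> = (\<Sum>\<phi>\<in>UNIV. det (\<chi> i. a i (\<phi> i)))"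
    unfolding det_def by (subst sum.swap) simp
  finally show ?thesis .
qed

text \<open>Expanding every row of the product as a combination of the rows of \<open>B\<close>
  gives a sum over all choices of a row of \<open>B\<close> for each row of \<open>A\<close>. A repeated
  choice contributes a vanishing determinant; the others are collected by their set of values, and
  for each set the sum over its orderings is the Leibniz formula for the minor of \<open>A\<close>.\<close>

theorem cauchy_binet:
  fixes A :: "'a::comm_ring_1 ^ 'k::{finite,linorder} ^ 'n::{finite,linorder}"
    and B :: "'a ^ 'n::{finite,linorder} ^ 'k::{finite,linorder}"
  shows "det (A ** B) =
    (\<Sum>e | strict_mono (e :: 'n \<Rightarrow> 'k). det (\<chi> j m. A $ j $ e m) * det (\<chi> m j. B $ e m $ j))"
proof -
  let ?term = "\<lambda>\<phi> :: 'n \<Rightarrow> 'k. (\<Prod>i\<in>UNIV. A $ i $ \<phi> i) * det (\<chi> i. B $ \<phi> i)"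
  have "A ** B = (\<chi> i. \<Sum>k\<in>UNIV. A $ i $ k *s B $ k)"
    by (simp add: matrix_matrix_mult_def vec_eq_iff)
  then have "det (A ** B) = (\<Sum>\<phi>\<in>UNIV. det (\<chi> i. A $ i $ \<phi> i *s B $ \<phi> i))"
    by (simp add: det_rows_sum)
  also have "\<dots> = (\<Sum>\<phi>\<in>UNIV. ?term \<phi>)"
    by (simp add: det_rows_mul)
  also have "\<dots> = (\<Sum>\<phi> | inj \<phi>. ?term \<phi>)"
  proof (rule sum.mono_neutral_right)
    show "\<forall>\<phi>\<in>UNIV - {\<phi>. inj \<phi>}. ?term \<phi> = 0"
    proof
      fix \<phi> :: "'n \<Rightarrow> 'k"
      assume "\<phi> \<in> UNIV - {\<phi>. inj \<phi>}"
      then obtain i j where "i \<noteq> j" "\<phi> i = \<phi> j"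
        by (auto simp: inj_def)
      then have "det (\<chi> i. B $ \<phi> i) = 0"
        by (intro det_identical_rows[of i j]) (auto simp: row_def)
      then show "?term \<phi> = 0" by simp
    qed
  qed auto
  also have "\<dots> = (\<Sum>(e, p) \<in> {e. strict_mono e} \<times> {p. p permutes UNIV}. ?term (e \<circ> p))"
    by (subst sum.reindex_bij_betw[OF bij_betw_strict_mono_permutes_inj, symmetric])
       (simp add: case_prod_beta)
  also have "\<dots> = (\<Sum>e | strict_mono (e :: 'n \<Rightarrow> 'k). \<Sum>p | p permutes (UNIV :: 'n set). ?term (e \<circ> p))"
    by (simp add: sum.cartesian_product)
  also have "\<dots> = (\<Sum>e | strict_mono (e :: 'n \<Rightarrow> 'k).
      det (\<chi> j m. A $ j $ e m) * det (\<chi> m j. B $ e m $ j))"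
  proof (rule sum.cong[OF refl])
    fix e :: "'n \<Rightarrow> 'k"
    have "?term (e \<circ> p) =
        (of_int (sign p) * (\<Prod>i\<in>UNIV. A $ i $ e (p i))) * det (\<chi> m j. B $ e m $ j)"
      if "p permutes UNIV" for p
    proof -
      have "det (\<chi> i. B $ e (p i)) = of_int (sign p) * det (\<chi> m j. B $ e m $ j)"
        using det_permute_rows[OF that, of "\<chi> m j. B $ e m $ j"]
        by (simp add: vec_lambda_eta cong: if_cong)
      then show ?thesis by simp
    qed
    then show "(\<Sum>p | p permutes (UNIV :: 'n set). ?term (e \<circ> p)) =
        det (\<chi> j m. A $ j $ e m) * det (\<chi> m j. B $ e m $ j)"
      by (simp add: det_def[of "\<chi> j m. A $ j $ e m"] sum_distrib_right)
  qed
  finally show ?thesis .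
qed

section \<open>Logarithmic coordinates and degrees\<close>

definition real_matrix :: "int ^ 'k ^ 'n \<Rightarrow> real ^ 'k ^ 'n" where
  "real_matrix V = (\<chi> j i. real_of_int (V $ j $ i))"

definition exponent :: "('k::finite \<Rightarrow>\<^sub>0 nat) \<Rightarrow> real ^ 'k" where
  "exponent l = (\<chi> i. real (Poly_Mapping.lookup l i))"

definition log_vec :: "real ^ 'k \<Rightarrow> real ^ 'k" where
  "log_vec x = (\<chi> i. ln (x $ i))"

definition exp_vec :: "real ^ 'k \<Rightarrow> real ^ 'k" where
  "exp_vec y = (\<chi> i. exp (y $ i))"

lemma log_exp_vec [simp]: "log_vec (exp_vec y) = y"
  by (simp add: log_vec_def exp_vec_def vec_eq_iff)

lemma exp_log_vec: "x \<in> positive_orthant \<Longrightarrow> exp_vec (log_vec x) = x"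
  by (simp add: log_vec_def exp_vec_def vec_eq_iff positive_orthant_def)

lemma exp_vec_positive [simp]: "exp_vec y \<in> positive_orthant"
  by (simp add: exp_vec_def positive_orthant_def)

lemma monomial_fun_exp:
  assumes "x \<in> positive_orthant"
  shows "monomial_fun l x = exp (log_vec x \<bullet> exponent l)"
proof -
  have "(x $ i) ^ n = exp (ln (x $ i) * real n)" for i n
    using assms by (simp add: positive_orthant_def exp_of_nat2_mult)
  then show ?thesis
    by (simp add: monomial_fun_def inner_vec_def log_vec_def exponent_def exp_sum)
qed

lemma cox_quotient_exp:
  fixes V :: "int ^ 'k ^ 'n"
  assumes "x \<in> positive_orthant"
  shows "cox_quotient V x = exp_vec (real_matrix V *v log_vec x)"
proof -
  have "(x $ i) powi n = exp (real_of_int n * ln (x $ i))" for i n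
    using assms exp_power_int[of "ln (x $ i)" n] by (simp add: positive_orthant_def mult.commute)
  then show ?thesis
    by (simp add: cox_quotient_def vec_eq_iff exp_vec_def matrix_vector_mult_def log_vec_def
        real_matrix_def exp_sum)
qed

lemma poly_fun_eq_sum:
  assumes "positive_coefficients f"
  shows "poly_fun f x =
    (\<Sum>l\<in>Poly_Mapping.keys f. Re (Poly_Mapping.lookup f l) * monomial_fun l x)"
proof -
  have "monomial_fun l (\<chi> i. complex_of_real (x $ i)) = complex_of_real (monomial_fun l x)" for l
    by (simp add: monomial_fun_def)
  then show ?thesis
    by (simp add: poly_fun_def cox_eval_def)
qed

text \<open>Equal classes differ by an integer combination of the rows of the ray matrix; read over
  the reals, this puts all the exponents of one degree into one affine subspace.\<close>

lemma exponent_diff_if_same_degree: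
  fixes V :: "int ^ 'k ^ 'n"
  assumes "monomial_degree V l = monomial_degree V m"
  obtains u where "exponent l = exponent m + transpose (real_matrix V) *v u"
proof -
  let ?e = "\<lambda>l :: 'k \<Rightarrow>\<^sub>0 nat. \<chi> i. int (Poly_Mapping.lookup l i)"
  have "(?e m, ?e m) \<in> linear_equivalence V"
    by (auto simp: linear_equivalence_def intro!: image_eqI[of _ _ 0])
  then have "(?e l, ?e m) \<in> linear_equivalence V"
    using assms by (auto simp: monomial_degree_def)
  then obtain a where a: "?e l - ?e m = transpose V *v a"
    by (auto simp: linear_equivalence_def)
  have "exponent l = exponent m + transpose (real_matrix V) *v real_vec a"
  proof (rule vec_eq_iff[THEN iffD2], rule allI)
    fix i
    have "int (Poly_Mapping.lookup l i) =
        int (Poly_Mapping.lookup m i) + (\<Sum>j\<in>UNIV. V $ j $ i * a $ j)"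
      using arg_cong[OF a, of "\<lambda>v. v $ i"]
      by (simp add: matrix_vector_mult_def transpose_def algebra_simps)
    then have "real_of_int (int (Poly_Mapping.lookup l i)) =
        real_of_int (int (Poly_Mapping.lookup m i) + (\<Sum>j\<in>UNIV. V $ j $ i * a $ j))"
      by (rule arg_cong)
    then show "exponent l $ i = (exponent m + transpose (real_matrix V) *v real_vec a) $ i"
      by (simp add: exponent_def matrix_vector_mult_def transpose_def real_matrix_def real_vec_def)
  qed
  then show ?thesis ..
qed

locale cox_pair =
  fixes V :: "int ^ 'k::{finite,linorder} ^ 'n::{finite,linorder}"
    and f g :: "'k cox_ring"
  assumes nonzero: "f \<noteq> 0" "g \<noteq> 0"
    and positive: "positive_coefficients f" "positive_coefficients g"
    and same_degree: "\<exists>\<alpha>. homogeneous V \<alpha> f \<and> homogeneous V \<alpha> g"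
    and full_dim: "aff_dim (newton_polytope g) = int CARD('n)"
    and interior: "newton_polytope f \<subseteq> rel_interior (newton_polytope g)"
begin

lemma keys_nonempty: "Poly_Mapping.keys f \<noteq> {}" "Poly_Mapping.keys g \<noteq> {}"
  using nonzero by simp_all

lemma exponent_diff:
  assumes "l \<in> Poly_Mapping.keys f \<union> Poly_Mapping.keys g"
    and "m \<in> Poly_Mapping.keys f \<union> Poly_Mapping.keys g"
  obtains u where "exponent l = exponent m + transpose (real_matrix V) *v u"
proof (rule exponent_diff_if_same_degree)
  show "monomial_degree V l = monomial_degree V m"
    using assms same_degree by (auto simp: homogeneous_def)
qed

lemma newton_polytope_eq:
  "newton_polytope p = convex hull (exponent ` Poly_Mapping.keys p)"
  by (simp add: newton_polytope_def exponent_def[abs_def])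

text \<open>Two exponents of the same degree differ by an element of the image of the transposed
  ray matrix, whose dimension is at most \<open>n\<close>. So a Newton polytope of dimension \<open>n\<close>
  fills a translate of this image, and the ray matrix has rank \<open>n\<close>.\<close>

lemma affine_hull_newton_polytope:
  assumes "m \<in> Poly_Mapping.keys g"
  shows "affine hull newton_polytope g =
      (+) (exponent m) ` range (\<lambda>u. transpose (real_matrix V) *v u)" (is "_ = ?T")
    and "surj (\<lambda>y. real_matrix V *v y)"
proof -
  let ?L = "range (\<lambda>u. transpose (real_matrix V) *v u)"
  have sub: "subspace ?L"
    by (intro linear_subspace_image subspace_UNIV matrix_vector_mul_linear)
  have aff: "affine ?T"
    using sub affine_translation subspace_imp_affine by blast
  have "exponent ` Poly_Mapping.keys g \<subseteq> ?T"
    using exponent_diff assms by (metis (no_types, lifting) UnI2 image_eqI image_subsetI rangeI)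
  then have "newton_polytope g \<subseteq> ?T"
    unfolding newton_polytope_eq using aff by (intro hull_minimal affine_imp_convex)
  then have subset: "affine hull newton_polytope g \<subseteq> ?T"
    using aff by (rule hull_minimal)
  have dim_L: "aff_dim ?T = int (dim ?L)"
    using sub by (simp add: aff_dim_translation_eq aff_dim_subspace)
  have rank: "dim ?L = rank (real_matrix V)"
    by (metis rank_dim_range rank_transpose)
  have "int CARD('n) \<le> int (dim ?L)"
    using aff_dim_subset[OF subset] unfolding aff_dim_affine_hull full_dim dim_L .
  moreover have "dim ?L \<le> CARD('n)"
    unfolding rank using rank_bound[of "real_matrix V"] by simp
  ultimately have dim_eq: "dim ?L = CARD('n)"
    by simp
  then show "surj (\<lambda>y. real_matrix V *v y)"
    unfolding full_rank_surjective[symmetric] using rank by simp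
  show "affine hull newton_polytope g = ?T"
  proof (rule affine_dim_equal)
    show "affine hull newton_polytope g \<noteq> {}"
      using keys_nonempty by (simp add: newton_polytope_eq)
  qed (use subset aff in \<open>simp_all only: dim_L dim_eq full_dim aff_dim_affine_hull affine_affine_hull\<close>)
qed

lemma surj_real_matrix: "surj (\<lambda>y. real_matrix V *v y)"
  using affine_hull_newton_polytope(2) keys_nonempty by blast

end

section \<open>Descent to the positive part and the canonical form\<close>

definition fibre_constant :: "int ^ 'k ^ 'n \<Rightarrow> (real ^ 'k \<Rightarrow> 'a) \<Rightarrow> bool" where
  "fibre_constant V F \<longleftrightarrow> (\<forall>x\<in>positive_orthant. \<forall>x'\<in>positive_orthant.
     cox_quotient V x = cox_quotient V x' \<longrightarrow> F x = F x')"

lemma descend_cox_quotient: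
  assumes "fibre_constant V F" "x \<in> positive_orthant"
  shows "descend V F (cox_quotient V x) = F x"
  unfolding descend_def
proof (rule the_equality)
  show "\<exists>x'\<in>positive_orthant. cox_quotient V x' = cox_quotient V x \<and> F x' = F x"
    using assms(2) by blast
next
  fix y
  assume "\<exists>x'\<in>positive_orthant. cox_quotient V x' = cox_quotient V x \<and> F x' = y"
  then show "y = F x"
    using assms unfolding fibre_constant_def by blast
qed

lemma open_positive_orthant: "open (positive_orthant :: (real ^ 'k) set)"
proof -
  have eq: "positive_orthant = (\<Inter>i\<in>UNIV. {x :: real ^ 'k. 0 < x $ i})"
    by (auto simp: positive_orthant_def)
  show ?thesis
    unfolding eq by (intro open_INT ballI open_Collect_less continuous_intros) simp
qed

lemma log_vec_measurable:
  "log_vec \<in> borel_measurable (restrict_space borel (positive_orthant :: (real ^ 'k) set))"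
proof (rule borel_measurable_continuous_on_restrict)
  show "continuous_on (positive_orthant :: (real ^ 'k) set) log_vec"
    unfolding log_vec_def
    by (intro continuous_intros) (auto simp: positive_orthant_def less_imp_neq[symmetric])
qed

lemma monomial_fun_measurable [measurable]:
  "monomial_fun l \<in> borel_measurable (borel :: (real ^ 'k) measure)"
  unfolding monomial_fun_def by (intro borel_measurable_continuous_onI continuous_intros)

lemma poly_fun_measurable:
  "positive_coefficients p \<Longrightarrow> poly_fun p \<in> borel_measurable borel"
  by (subst measurable_cong[OF poly_fun_eq_sum]) (assumption, measurable)

lemma trop_fun_measurable [measurable]: "trop_fun p \<in> borel_measurable borel"
  unfolding trop_fun_def by (intro borel_measurable_Max) simp_all

text \<open>The quotient map is linear in logarithmic coordinates, so its logarithmic derivative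
  is the constant matrix \<open>real_matrix V\<close>.\<close>

lemma cox_quotient_has_derivative:
  fixes V :: "int ^ 'k ^ 'n"
  assumes x: "x \<in> positive_orthant"
  shows "(cox_quotient V has_derivative
     (\<lambda>w. \<chi> j. cox_quotient V x $ j * (real_matrix V *v (\<chi> i. w $ i / x $ i)) $ j)) (at x)"
    (is "(_ has_derivative ?D) _")
proof (rule has_derivative_transform_within_open[OF _ open_positive_orthant x])
  have nth: "((\<lambda>x. x $ i) has_derivative (\<lambda>w. w $ i)) (at x)" for i :: 'k
    by (intro bounded_linear_imp_has_derivative bounded_linear_vec_nth)
  have ln: "((\<lambda>x. ln (x $ i)) has_derivative (\<lambda>w. w $ i / x $ i)) (at x)" for i
    using x by (auto intro!: derivative_eq_intros nth simp: positive_orthant_def divide_inverse)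
  have "((\<lambda>x. exp (\<Sum>i\<in>UNIV. real_of_int (V $ j $ i) * ln (x $ i))) has_derivative
      (\<lambda>w. cox_quotient V x $ j * (\<Sum>i\<in>UNIV. real_of_int (V $ j $ i) * (w $ i / x $ i)))) (at x)" for j
  proof -
    have "((\<lambda>x. \<Sum>i\<in>UNIV. real_of_int (V $ j $ i) * ln (x $ i)) has_derivative
        (\<lambda>w. \<Sum>i\<in>UNIV. real_of_int (V $ j $ i) * (w $ i / x $ i))) (at x)"
      by (intro has_derivative_sum has_derivative_mult_right ln)
    from has_derivative_exp[OF this] show ?thesis
      using x by (simp add: cox_quotient_exp exp_vec_def matrix_vector_mult_def log_vec_def
          real_matrix_def mult.commute[of "exp _"])
  qed
  then show "((\<lambda>x. exp_vec (real_matrix V *v log_vec x)) has_derivative ?D) (at x)"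
    by (subst has_derivative_componentwise_within)
       (auto simp: Basis_vec_def inner_axis exp_vec_def matrix_vector_mult_def log_vec_def
         real_matrix_def)
qed (simp add: cox_quotient_exp)

lemma of_int_det: "(of_int (det A) :: 'a::comm_ring_1) = det (\<chi> i j. of_int (A $ i $ j))"
  by (simp add: det_def)

text \<open>The form on the torus is \<open>\<And>\<^sub>j dt\<^sub>j / t\<^sub>j\<close>, and its
  pullback is the determinant of the matrix of logarithmic derivatives \<open>V \<cdot> (w'/x)\<close>.
  By Cauchy-Binet this is the sum of products of minors that defines the canonical form. The right
  side depends on \<open>w'\<close> and \<open>x\<close> only through their images, which makes the form on
  the quotient well defined.\<close>

lemma canonical_form_eq_det:
  fixes V :: "int ^ 'k::{finite,linorder} ^ 'n::{finite,linorder}"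
  assumes x: "x \<in> positive_orthant"
    and w: "\<And>j. frechet_derivative (cox_quotient V) (at x) (w' j) = w j"
  shows "canonical_form V x w' = det (\<chi> i j. w j $ i / cox_quotient V x $ i)"
proof -
  define B :: "real ^ 'n::{finite,linorder} ^ 'k::{finite,linorder}" where "B = (\<chi> i j. w' j $ i / x $ i)"
  have pos: "cox_quotient V x $ i > 0" for i
    using x by (simp add: cox_quotient_exp exp_vec_def)
  have w_eq: "w j $ i = cox_quotient V x $ i * (real_matrix V *v (\<chi> m. w' j $ m / x $ m)) $ i" for i j
    by (simp add: w[symmetric] frechet_derivative_at[OF cox_quotient_has_derivative[OF x], symmetric])
  have "real_matrix V ** B = (\<chi> i j. w j $ i / cox_quotient V x $ i)"
    using pos by (simp add: w_eq vec_eq_iff less_imp_neq[symmetric] matrix_matrix_mult_def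
        matrix_vector_mult_def B_def)
  then have "det (\<chi> i j. w j $ i / cox_quotient V x $ i) = det (real_matrix V ** B)"
    by simp
  also have "\<dots> = canonical_form V x w'"
    by (simp add: cauchy_binet canonical_form_def of_int_det real_matrix_def B_def)
  finally show ?thesis ..
qed

context cox_pair
begin

text \<open>A right inverse of the ray matrix yields a continuous section of the quotient map:
  a function that is constant on the fibres can be evaluated along it, which replaces the definite
  description in \<open>descend\<close> by a formula and gives measurability.\<close>

definition right_inverse :: "real ^ 'n::{finite,linorder} ^ 'k::{finite,linorder}" where
  "right_inverse = (SOME B. real_matrix V ** B = mat 1)"

definition lift :: "real ^ 'n::{finite,linorder} \<Rightarrow> real ^ 'k::{finite,linorder}" where
  "lift t = exp_vec (right_inverse *v log_vec t)"

lemma right_inverse: "real_matrix V ** right_inverse = mat 1"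
proof -
  have "\<exists>B. real_matrix V ** B = mat 1"
    using surj_real_matrix by (simp add: matrix_right_invertible_surjective)
  then show ?thesis
    unfolding right_inverse_def by (rule someI_ex)
qed

lemma real_matrix_right_inverse [simp]: "real_matrix V *v (right_inverse *v y) = y"
  by (simp add: matrix_vector_mul_assoc right_inverse)

lemma lift_positive [simp]: "lift t \<in> positive_orthant"
  by (simp add: lift_def)

lemma cox_quotient_lift: "t \<in> positive_orthant \<Longrightarrow> cox_quotient V (lift t) = t"
  by (simp add: cox_quotient_exp exp_log_vec) (simp add: lift_def exp_log_vec)

lemma positive_part_eq: "positive_part V = positive_orthant"
proof
  show "positive_part V \<subseteq> positive_orthant"
    by (auto simp: positive_part_def cox_quotient_exp)
  show "positive_orthant \<subseteq> positive_part V"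
  proof
    fix t :: "real ^ 'n::{finite,linorder}"
    assume "t \<in> positive_orthant"
    then have "t = cox_quotient V (lift t)"
      by (simp add: cox_quotient_lift)
    then show "t \<in> positive_part V"
      unfolding positive_part_def by (rule image_eqI) simp
  qed
qed

lemma descend_eq:
  assumes "fibre_constant V F" "t \<in> positive_orthant"
  shows "descend V F t = F (lift t)"
  using descend_cox_quotient[OF assms(1), of "lift t"] assms(2) by (simp add: cox_quotient_lift)

lemma canonical_form_on_X_axis:
  assumes t: "t \<in> positive_orthant"
  shows "canonical_form_on_X V t (\<lambda>j. axis j 1) = (\<Prod>j\<in>UNIV. 1 / t $ j)"
proof -
  have det: "det (\<chi> i j. (axis j 1 :: real ^ 'n::{finite,linorder}) $ i / t $ i) = (\<Prod>j\<in>UNIV. 1 / t $ j)"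
    by (subst det_diagonal) (auto simp: axis_def)
  \<comment> \<open>Lifts of the coordinate vectors: dividing by \<open>t\<close> and multiplying by \<open>lift t\<close>
    converts between tangent vectors and logarithmic ones.\<close>
  define w' where
    "w' j = (\<chi> i. lift t $ i * (right_inverse *v (\<chi> a. (axis j 1 :: real ^ 'n::{finite,linorder}) $ a / t $ a)) $ i)" for j
  have nz: "lift t $ i \<noteq> 0" "t $ j \<noteq> 0" for i j
    using t lift_positive[of t] unfolding positive_orthant_def by (auto simp: less_imp_neq[symmetric])
  have lifts: "frechet_derivative (cox_quotient V) (at (lift t)) (w' j) = axis j 1" for j
    using nz
    by (simp add: frechet_derivative_at[OF cox_quotient_has_derivative[OF lift_positive], symmetric]
        w'_def cox_quotient_lift[OF t] vec_lambda_eta vec_eq_iff)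
  show ?thesis
    unfolding canonical_form_on_X_def
  proof (rule the_equality)
    show "\<exists>x\<in>positive_orthant. \<exists>w'. cox_quotient V x = t \<and>
        (\<forall>j. frechet_derivative (cox_quotient V) (at x) (w' j) = axis j 1) \<and>
        canonical_form V x w' = (\<Prod>j\<in>UNIV. 1 / t $ j)"
      using lifts canonical_form_eq_det[OF lift_positive lifts] det
      by (intro bexI[of _ "lift t"] exI[of _ w']) (auto simp: cox_quotient_lift[OF t])
  next
    fix y
    assume "\<exists>x\<in>positive_orthant. \<exists>w'. cox_quotient V x = t \<and>
        (\<forall>j. frechet_derivative (cox_quotient V) (at x) (w' j) = axis j 1) \<and>
        canonical_form V x w' = y"
    then obtain x w' where "x \<in> positive_orthant" "cox_quotient V x = t"
      and "\<And>j. frechet_derivative (cox_quotient V) (at x) (w' j) = axis j 1"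
      and "canonical_form V x w' = y"
      by blast
    then show "y = (\<Prod>j\<in>UNIV. 1 / t $ j)"
      using canonical_form_eq_det[of x V w' "\<lambda>j. axis j 1"] det by simp
  qed
qed

lemma canonical_measure_eq:
  "canonical_measure V =
     density (restrict_space lborel positive_orthant) (\<lambda>t. ennreal (\<Prod>j\<in>UNIV. 1 / t $ j))"
proof -
  let ?M = "restrict_space lborel (positive_orthant :: (real ^ 'n::{finite,linorder}) set)"
  have meas: "(\<lambda>t. ennreal (\<Prod>j\<in>UNIV. 1 / t $ j)) \<in> borel_measurable ?M"
    by (intro measurable_restrict_space1) simp
  have eq: "\<bar>canonical_form_on_X V t (\<lambda>j. axis j 1)\<bar> = (\<Prod>j\<in>UNIV. 1 / t $ j)"
    if "t \<in> positive_orthant" for t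
    using that by (auto simp: canonical_form_on_X_axis abs_prod positive_orthant_def abs_of_pos intro!: prod.cong)
  show ?thesis
    unfolding canonical_measure_def positive_part_eq
  proof (rule density_cong)
    show "(\<lambda>t. ennreal \<bar>canonical_form_on_X V t (\<lambda>j. axis j 1)\<bar>) \<in> borel_measurable ?M"
      using meas by (subst measurable_cong[OF arg_cong[OF eq]]) (auto simp: space_restrict_space)
  qed (auto simp: eq space_restrict_space intro!: meas AE_I2)
qed

lemma space_canonical_measure [simp]: "space (canonical_measure V) = positive_orthant"
  by (simp add: canonical_measure_eq space_restrict_space)

lemma sets_canonical_measure [measurable_cong]:
  "sets (canonical_measure V) = sets (restrict_space borel positive_orthant)"
  by (simp add: canonical_measure_eq sets_restrict_space)

lemma lift_measurable: "lift \<in> borel_measurable (canonical_measure V)"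
proof -
  have "(\<lambda>y. exp_vec (right_inverse *v y)) \<in> borel_measurable borel"
    unfolding exp_vec_def
    by (intro borel_measurable_continuous_onI continuous_intros
        linear_continuous_on matrix_vector_mul_bounded_linear)
  from measurable_compose[OF log_vec_measurable this] show ?thesis
    unfolding lift_def by (simp add: measurable_cong_sets[OF sets_canonical_measure refl])
qed

lemma descend_measurable:
  assumes "fibre_constant V F" "F \<in> borel_measurable borel"
  shows "descend V F \<in> borel_measurable (canonical_measure V)"
proof -
  have "(\<lambda>t. F (lift t)) \<in> borel_measurable (canonical_measure V)"
    using lift_measurable assms(2) by (rule measurable_compose)
  then show ?thesis
    by (subst measurable_cong[OF descend_eq]) (use assms in auto)
qed

text \<open>Points of one fibre differ, in logarithms, by a kernel vector of \<open>real_matrix V\<close>.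
  Such a vector is orthogonal to the differences of exponents of equal degree, so moving within the
  fibre multiplies all the monomials by one common factor.\<close>

lemma monomial_fun_fibre:
  assumes x: "x \<in> positive_orthant" "x' \<in> positive_orthant"
    and eq: "cox_quotient V x = cox_quotient V x'"
  obtains c where "c > 0"
    and "\<And>l. l \<in> Poly_Mapping.keys f \<union> Poly_Mapping.keys g \<Longrightarrow>
           monomial_fun l x' = c * monomial_fun l x"
proof -
  define d where "d = log_vec x' - log_vec x"
  have "real_matrix V *v log_vec x = real_matrix V *v log_vec x'"
    using arg_cong[OF eq, of log_vec] x by (simp add: cox_quotient_exp)
  then have ker: "real_matrix V *v d = 0"
    by (simp add: d_def matrix_vector_mult_diff_distrib)
  obtain m where m: "m \<in> Poly_Mapping.keys g"
    using keys_nonempty by blast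
  have "monomial_fun l x' = exp (d \<bullet> exponent m) * monomial_fun l x"
    if l: "l \<in> Poly_Mapping.keys f \<union> Poly_Mapping.keys g" for l
  proof -
    obtain u where u: "exponent l = exponent m + transpose (real_matrix V) *v u"
      using exponent_diff l m by blast
    have "d \<bullet> (transpose (real_matrix V) *v u) = 0"
      using ker dot_lmul_matrix[of u "real_matrix V" d] by (simp add: inner_commute)
    then have "d \<bullet> exponent l = d \<bullet> exponent m"
      by (simp add: u inner_add_right)
    moreover have "log_vec x' = d + log_vec x"
      by (simp add: d_def)
    ultimately show ?thesis
      using x by (simp add: monomial_fun_exp inner_add_left exp_add)
  qed
  then show ?thesis
    by (intro that[of "exp (d \<bullet> exponent m)"]) auto
qed

lemma fibre_scaling:
  assumes x: "x \<in> positive_orthant" "x' \<in> positive_orthant"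
    and eq: "cox_quotient V x = cox_quotient V x'"
  obtains c where "c > 0" "poly_fun f x' = c * poly_fun f x" "poly_fun g x' = c * poly_fun g x"
    "trop_fun f x' = c * trop_fun f x" "trop_fun g x' = c * trop_fun g x"
proof -
  obtain c where c: "c > 0"
    and mon: "\<And>l. l \<in> Poly_Mapping.keys f \<union> Poly_Mapping.keys g \<Longrightarrow>
      monomial_fun l x' = c * monomial_fun l x"
    using monomial_fun_fibre[OF assms] by blast
  have poly: "poly_fun p x' = c * poly_fun p x"
    if "p \<in> {f, g}" for p
    using that positive mon
    by (auto simp: poly_fun_eq_sum sum_distrib_left mult.left_commute intro!: sum.cong)
  have trop: "trop_fun p x' = c * trop_fun p x"
    if "p \<in> {f, g}" for p
  proof -
    have "trop_fun p x' = Max ((*) c ` (\<lambda>l. monomial_fun l x) ` Poly_Mapping.keys p)"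
      unfolding trop_fun_def image_image
      by (intro arg_cong[where f = Max] image_cong) (use that mon in auto)
    also have "\<dots> = c * trop_fun p x"
      unfolding trop_fun_def using c that keys_nonempty
      by (intro mono_Max_commute[symmetric]) (auto simp: mono_def)
    finally show ?thesis .
  qed
  from c poly trop show ?thesis
    by (intro that[of c]) auto
qed

lemma fibre_constant_ratios:
  shows "fibre_constant V (\<lambda>x. poly_fun f x / poly_fun g x)"
    and "fibre_constant V (\<lambda>x. trop_fun f x / trop_fun g x)"
    and "fibre_constant V (\<lambda>x. poly_fun f x * trop_fun g x / (poly_fun g x * trop_fun f x))"
proof -
  show "fibre_constant V (\<lambda>x. poly_fun f x / poly_fun g x)"
    "fibre_constant V (\<lambda>x. trop_fun f x / trop_fun g x)"
    "fibre_constant V (\<lambda>x. poly_fun f x * trop_fun g x / (poly_fun g x * trop_fun f x))"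
    unfolding fibre_constant_def by (intro ballI impI, erule (2) fibre_scaling, simp)+
qed

end

section \<open>Exponential decay and integrability\<close>

lemma nn_integral_exp_log_decay:
  fixes \<epsilon> :: real
  assumes "\<epsilon> > 0"
  shows "(\<integral>\<^sup>+u. ennreal (indicator {0<..} u * (exp (- \<epsilon> * \<bar>ln u\<bar>) / u)) \<partial>lborel) < \<infinity>"
proof -
  let ?f = "\<lambda>u. ennreal (u powr (\<epsilon> - 1)) * indicator {0..1} u"
  let ?g = "\<lambda>u. ennreal (u powr (- \<epsilon> - 1)) * indicator {1..} u"
  have near_0: "(\<integral>\<^sup>+u. ?f u \<partial>lborel) = ennreal (1 powr \<epsilon> / \<epsilon>)"
    using has_integral_powr_from_0[of "\<epsilon> - 1" 1] assms
    by (intro nn_integral_has_integral_lebesgue') auto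
  have near_infinity: "(\<integral>\<^sup>+u. ?g u \<partial>lborel) = ennreal (- (1 powr - \<epsilon>) / - \<epsilon>)"
    using has_integral_powr_to_inf[of "- \<epsilon> - 1" 1] assms
    by (intro nn_integral_has_integral_lebesgue') auto
  have le: "ennreal (indicator {0<..} u * (exp (- \<epsilon> * \<bar>ln u\<bar>) / u)) \<le> ?f u + ?g u" for u
  proof (cases "u > 0")
    case True
    have powr_eq: "u powr (a - 1) = exp (a * ln u) / u" for a
      using True by (simp add: powr_diff) (simp add: powr_def)
    show ?thesis
    proof (cases "u \<le> 1")
      case True
      with \<open>u > 0\<close> have "ennreal (indicator {0<..} u * (exp (- \<epsilon> * \<bar>ln u\<bar>) / u)) = ?f u"
        by (simp add: powr_eq)
      then show ?thesis by simp
    next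
      case False
      with \<open>u > 0\<close> have "ennreal (indicator {0<..} u * (exp (- \<epsilon> * \<bar>ln u\<bar>) / u)) = ?g u"
        by (simp add: powr_eq)
      then show ?thesis by simp
    qed
  qed simp
  have "(\<integral>\<^sup>+u. ennreal (indicator {0<..} u * (exp (- \<epsilon> * \<bar>ln u\<bar>) / u)) \<partial>lborel)
      \<le> (\<integral>\<^sup>+u. ?f u + ?g u \<partial>lborel)"
    by (intro nn_integral_mono le)
  also have "\<dots> = (\<integral>\<^sup>+u. ?f u \<partial>lborel) + (\<integral>\<^sup>+u. ?g u \<partial>lborel)"
    by (intro nn_integral_add) simp_all
  also have "\<dots> < \<infinity>"
    unfolding near_0 near_infinity by simp
  finally show ?thesis .
qed

text \<open>In the coordinates \<open>ln t\<^sub>j\<close> this is the integral of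
  \<open>exp (- \<epsilon> \<parallel>y\<parallel>\<^sub>1)\<close> over the whole space. The integrand is a product of
  functions of one coordinate, so the one-dimensional case suffices.\<close>

lemma nn_integral_exp_log_vec_decay:
  fixes \<epsilon> :: real
  assumes "\<epsilon> > 0"
  shows "(\<integral>\<^sup>+t. ennreal (\<Prod>j\<in>UNIV. indicator {0<..} (t $ j) * (exp (- \<epsilon> * \<bar>ln (t $ j)\<bar>) / t $ j))
     \<partial>(lborel :: (real ^ 'n) measure)) < \<infinity>"
proof -
  let ?\<phi> = "\<lambda>u :: real. indicator {0<..} u * (exp (- \<epsilon> * \<bar>ln u\<bar>) / u)"
  have nonneg: "0 \<le> ?\<phi> u" for u
    by (simp add: indicator_def)
  have basis: "(\<Prod>b\<in>(Basis :: (real ^ 'n) set). \<psi> b) = (\<Prod>j\<in>UNIV. \<psi> (axis j 1))"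
    for \<psi> :: "real ^ 'n \<Rightarrow> ennreal"
  proof -
    have eq: "(Basis :: (real ^ 'n) set) = range (\<lambda>j. axis j 1)"
      by (auto simp: Basis_vec_def)
    have inj: "inj (\<lambda>j. axis j 1 :: real ^ 'n)"
      by (auto simp: inj_def axis_eq_axis)
    show ?thesis
      unfolding eq by (simp add: prod.reindex[OF inj])
  qed
  have nth: "t \<bullet> axis j 1 = t $ j" for t :: "real ^ 'n" and j
    by (simp add: inner_axis)
  have "(\<integral>\<^sup>+t. ennreal (\<Prod>j\<in>UNIV. ?\<phi> (t $ j)) \<partial>(lborel :: (real ^ 'n) measure)) =
      (\<integral>\<^sup>+t. (\<Prod>b\<in>Basis. ennreal (?\<phi> (t \<bullet> b))) \<partial>(lborel :: (real ^ 'n) measure))"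
    unfolding basis nth by (intro nn_integral_cong prod_ennreal[symmetric] nonneg)
  also have "\<dots> = (\<Prod>b\<in>(Basis :: (real ^ 'n) set). \<integral>\<^sup>+u. ennreal (?\<phi> u) \<partial>lborel)"
    by (rule nn_integral_lborel_prod) simp_all
  also have "\<dots> < \<infinity>"
    using nn_integral_exp_log_decay[OF assms] by (simp add: power_less_top_ennreal)
  finally show ?thesis .
qed

lemma normalized_measure_prob_space:
  assumes int: "integrable M F" and pos: "\<And>x. x \<in> space M \<Longrightarrow> 0 < F x"
    and nonzero: "emeasure M (space M) \<noteq> 0"
  shows "integral\<^sup>L M F > 0" and "prob_space (normalized_measure M F)"
proof -
  have nonneg: "AE x in M. 0 \<le> F x"
    using pos by (intro AE_I2) (simp add: less_imp_le)
  have "integral\<^sup>L M F \<noteq> 0"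
  proof
    assume "integral\<^sup>L M F = 0"
    then have "AE x in M. F x = 0"
      using integral_nonneg_eq_0_iff_AE[OF int nonneg] by simp
    then have "AE x in M. False"
    proof (rule AE_mp, intro AE_I2 impI)
      fix x
      assume "x \<in> space M" "F x = 0"
      then show False
        using pos[of x] by simp
    qed
    then show False
      using nonzero AE_iff_measurable[of "space M" M "\<lambda>_. False"] by simp
  qed
  moreover have "integral\<^sup>L M F \<ge> 0"
    using nonneg by (rule integral_nonneg_AE)
  ultimately show I: "integral\<^sup>L M F > 0"
    by simp
  have "emeasure (normalized_measure M F) (space M) =
      (\<integral>\<^sup>+x. ennreal (1 / integral\<^sup>L M F * F x) \<partial>M)"
    using int unfolding normalized_measure_def
    by (subst emeasure_density) (auto intro!: nn_integral_cong)
  also have "\<dots> = ennreal (\<integral>x. 1 / integral\<^sup>L M F * F x \<partial>M)"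
    using int nonneg I by (intro nn_integral_eq_integral) auto
  also have "\<dots> = 1"
    using I by simp
  finally show "prob_space (normalized_measure M F)"
    by (intro prob_spaceI) (simp add: normalized_measure_def)
qed

context cox_pair
begin

text \<open>This is where the interior hypothesis enters: exponents of \<open>f\<close> can be moved
  in all the directions of the affine hull of the Newton polytope of \<open>g\<close> without leaving it.\<close>

lemma exponent_perturbed:
  assumes l: "l \<in> Poly_Mapping.keys f"
  obtains \<epsilon> where "\<epsilon> > 0" and
    "\<And>s. (\<And>j. \<bar>s $ j\<bar> \<le> \<epsilon>) \<Longrightarrow>
      exponent l + transpose (real_matrix V) *v s \<in> newton_polytope g"
proof -
  have "exponent l \<in> newton_polytope f"
    using l by (simp add: newton_polytope_eq hull_inc)
  then have "exponent l \<in> rel_interior (newton_polytope g)"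
    using interior by blast
  then obtain r where r: "r > 0"
    and ball: "cball (exponent l) r \<inter> affine hull newton_polytope g \<subseteq> newton_polytope g"
    unfolding mem_rel_interior_cball by blast
  have "bounded_linear (\<lambda>s. transpose (real_matrix V) *v s)"
    by (rule matrix_vector_mul_bounded_linear)
  then obtain K where K: "K > 0" "\<And>s. norm (transpose (real_matrix V) *v s) \<le> norm s * K"
    using bounded_linear.pos_bounded by blast
  \<comment> \<open>The factor \<open>n\<close> passes from the maximum norm to the Euclidean one, and
    \<open>K\<close> bounds the operator norm of the transposed ray matrix.\<close>
  define \<epsilon> where "\<epsilon> = r / (CARD('n) * K)"
  show ?thesis
  proof
    show "\<epsilon> > 0"
      using r K by (simp add: \<epsilon>_def)
  next
    fix s :: "real ^ 'n::{finite,linorder}"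
    assume s: "\<And>j. \<bar>s $ j\<bar> \<le> \<epsilon>"
    have "norm s \<le> (\<Sum>j\<in>UNIV. \<bar>s $ j\<bar>)"
      by (rule norm_le_l1_cart)
    also have "\<dots> \<le> CARD('n) * \<epsilon>"
      using s by (intro sum_bounded_above) auto
    finally have "norm s * K \<le> r"
      using K by (simp add: \<epsilon>_def field_simps)
    then have "norm (transpose (real_matrix V) *v s) \<le> r"
      using K(2)[of s] by simp
    then have "exponent l + transpose (real_matrix V) *v s \<in> cball (exponent l) r"
      by (simp add: dist_norm)
    moreover obtain m where m: "m \<in> Poly_Mapping.keys g"
      using keys_nonempty by blast
    then obtain u where "exponent l = exponent m + transpose (real_matrix V) *v u"
      using exponent_diff l by blast
    then have "exponent l + transpose (real_matrix V) *v s =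
        exponent m + transpose (real_matrix V) *v (u + s)"
      by (simp only: matrix_vector_right_distrib add.assoc)
    then have "exponent l + transpose (real_matrix V) *v s \<in> affine hull newton_polytope g"
      unfolding affine_hull_newton_polytope(1)[OF m] by blast
    ultimately show "exponent l + transpose (real_matrix V) *v s \<in> newton_polytope g"
      using ball by blast
  qed
qed

lemma monomial_le_trop:
  "l \<in> Poly_Mapping.keys p \<Longrightarrow> monomial_fun l x \<le> trop_fun p x"
  by (simp add: trop_fun_def)

text \<open>A linear functional on a polytope is bounded by its maximum over the exponents that
  span it.\<close>

lemma exp_le_trop_if_newton_polytope:
  assumes "q \<in> newton_polytope g" "x \<in> positive_orthant"
  shows "exp (log_vec x \<bullet> q) \<le> trop_fun g x"
proof -
  obtain m where "m \<in> Poly_Mapping.keys g"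
    using keys_nonempty by blast
  then have "0 < trop_fun g x"
    using monomial_le_trop[of m g x] assms(2) by (simp add: monomial_fun_exp less_le_trans[OF exp_gt_zero])
  moreover from this have "newton_polytope g \<subseteq> {q. log_vec x \<bullet> q \<le> ln (trop_fun g x)}"
    unfolding newton_polytope_eq using assms(2)
    by (intro hull_minimal convex_halfspace_le)
       (auto simp: ln_ge_iff monomial_fun_exp[symmetric] intro: monomial_le_trop)
  ultimately show ?thesis
    using assms(1) by (auto simp: ln_ge_iff)
qed

text \<open>With \<open>y = ln t\<close>, moving the exponent \<open>l\<close> that realises
  \<open>trop_fun f x\<close> by the image of \<open>s = \<epsilon> sgn y\<close> multiplies its monomial by
  \<open>exp (\<epsilon> \<parallel>y\<parallel>\<^sub>1)\<close>, and the moved exponent still lies in the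
  Newton polytope of \<open>g\<close>.\<close>

lemma trop_decay:
  obtains \<epsilon> where "\<epsilon> > 0" and
    "\<And>x. x \<in> positive_orthant \<Longrightarrow>
      trop_fun f x \<le> exp (- \<epsilon> * (\<Sum>j\<in>UNIV. \<bar>(real_matrix V *v log_vec x) $ j\<bar>)) * trop_fun g x"
proof -
  have "\<exists>\<epsilon>>0. \<forall>s. (\<forall>j. \<bar>s $ j\<bar> \<le> \<epsilon>) \<longrightarrow>
      exponent l + transpose (real_matrix V) *v s \<in> newton_polytope g"
    if "l \<in> Poly_Mapping.keys f" for l
    using exponent_perturbed[OF that] by metis
  then obtain \<delta> where \<delta>: "\<And>l. l \<in> Poly_Mapping.keys f \<Longrightarrow> \<delta> l > 0"
    "\<And>l s. l \<in> Poly_Mapping.keys f \<Longrightarrow> (\<And>j. \<bar>s $ j\<bar> \<le> \<delta> l) \<Longrightarrow>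
      exponent l + transpose (real_matrix V) *v s \<in> newton_polytope g"
    by metis
  define \<epsilon> where "\<epsilon> = Min (\<delta> ` Poly_Mapping.keys f)"
  have \<epsilon>_pos: "\<epsilon> > 0"
    using \<delta>(1) keys_nonempty by (simp add: \<epsilon>_def)
  have \<epsilon>_le: "\<epsilon> \<le> \<delta> l" if "l \<in> Poly_Mapping.keys f" for l
    using that by (simp add: \<epsilon>_def)
  show ?thesis
  proof (rule that[OF \<epsilon>_pos])
    fix x :: "real ^ 'k::{finite,linorder}"
    assume x: "x \<in> positive_orthant"
    define y where "y = real_matrix V *v log_vec x"
    define s :: "real ^ 'n::{finite,linorder}" where "s = (\<chi> j. \<epsilon> * sgn (y $ j))"
    have "trop_fun f x \<in> (\<lambda>l. monomial_fun l x) ` Poly_Mapping.keys f"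
      unfolding trop_fun_def using keys_nonempty by (intro Max_in) auto
    then obtain l where l: "l \<in> Poly_Mapping.keys f" "trop_fun f x = monomial_fun l x"
      by auto
    have s_le: "\<bar>s $ j\<bar> \<le> \<delta> l" for j
      using \<epsilon>_le[OF l(1)] \<epsilon>_pos \<delta>(1)[OF l(1)] by (simp add: s_def abs_mult sgn_if)
    have "exp (log_vec x \<bullet> (exponent l + transpose (real_matrix V) *v s)) \<le> trop_fun g x"
      by (rule exp_le_trop_if_newton_polytope[OF \<delta>(2)[OF l(1) s_le] x])
    moreover have "log_vec x \<bullet> (transpose (real_matrix V) *v s) = y \<bullet> s"
      using dot_lmul_matrix[of s "real_matrix V" "log_vec x"] by (simp add: inner_commute y_def)
    moreover have "y \<bullet> s = \<epsilon> * (\<Sum>j\<in>UNIV. \<bar>y $ j\<bar>)"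
      by (simp add: inner_vec_def s_def sum_distrib_left abs_sgn mult.left_commute)
    ultimately have "trop_fun f x * exp (\<epsilon> * (\<Sum>j\<in>UNIV. \<bar>y $ j\<bar>)) \<le> trop_fun g x"
      using x by (simp add: inner_add_right exp_add l(2) monomial_fun_exp)
    then have "exp (- \<epsilon> * (\<Sum>j\<in>UNIV. \<bar>y $ j\<bar>)) * (trop_fun f x * exp (\<epsilon> * (\<Sum>j\<in>UNIV. \<bar>y $ j\<bar>)))
        \<le> exp (- \<epsilon> * (\<Sum>j\<in>UNIV. \<bar>y $ j\<bar>)) * trop_fun g x"
      by (intro mult_left_mono) auto
    then show "trop_fun f x \<le>
        exp (- \<epsilon> * (\<Sum>j\<in>UNIV. \<bar>(real_matrix V *v log_vec x) $ j\<bar>)) * trop_fun g x"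
      by (simp add: y_def[symmetric] mult.left_commute exp_minus_inverse flip: exp_add)
  qed
qed

lemma poly_trop_pos:
  assumes x: "x \<in> positive_orthant"
  shows "0 < poly_fun f x" "0 < poly_fun g x" "0 < trop_fun f x" "0 < trop_fun g x"
proof -
  have trop: "0 < trop_fun p x" and poly: "0 < poly_fun p x" if p: "p \<in> {f, g}" for p
  proof -
    obtain m where "m \<in> Poly_Mapping.keys p"
      using keys_nonempty p by blast
    then show "0 < trop_fun p x"
      using monomial_le_trop[of m p x] x by (simp add: monomial_fun_exp less_le_trans[OF exp_gt_zero])
    have "positive_coefficients p" "Poly_Mapping.keys p \<noteq> {}"
      using p positive keys_nonempty by auto
    then show "0 < poly_fun p x"
      using x by (auto simp: poly_fun_eq_sum positive_coefficients_def monomial_fun_exp intro!: sum_pos)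
  qed
  from trop poly show "0 < poly_fun f x" "0 < poly_fun g x" "0 < trop_fun f x" "0 < trop_fun g x"
    by auto
qed

text \<open>The numerator is estimated by replacing every monomial of \<open>f\<close> by the largest
  one, the denominator by keeping a single largest monomial of \<open>g\<close>.\<close>

lemma poly_ratio_le:
  assumes x: "x \<in> positive_orthant"
  shows "poly_fun f x * trop_fun g x / (poly_fun g x * trop_fun f x) \<le> M2 f g"
proof -
  let ?F = "\<Sum>l\<in>Poly_Mapping.keys f. Re (Poly_Mapping.lookup f l)"
  let ?G = "Min ((\<lambda>l. Re (Poly_Mapping.lookup g l)) ` Poly_Mapping.keys g)"
  have F_pos: "?F > 0"
    using positive(1) keys_nonempty by (intro sum_pos) (auto simp: positive_coefficients_def)
  have G_pos: "?G > 0"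
    using positive(2) keys_nonempty by (simp add: positive_coefficients_def)
  have F: "poly_fun f x \<le> ?F * trop_fun f x"
    unfolding poly_fun_eq_sum[OF positive(1)] sum_distrib_right using positive(1)
    by (intro sum_mono mult_left_mono monomial_le_trop)
       (auto simp: positive_coefficients_def less_imp_le)
  have "trop_fun g x \<in> (\<lambda>l. monomial_fun l x) ` Poly_Mapping.keys g"
    unfolding trop_fun_def using keys_nonempty by (intro Max_in) auto
  then obtain m where m: "m \<in> Poly_Mapping.keys g" "trop_fun g x = monomial_fun m x"
    by auto
  have "?G * trop_fun g x \<le> Re (Poly_Mapping.lookup g m) * monomial_fun m x"
    using m x by (auto simp: monomial_fun_exp intro!: mult_right_mono)
  also have "\<dots> \<le> poly_fun g x"
    unfolding poly_fun_eq_sum[OF positive(2)] using m x positive(2)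
    by (intro member_le_sum) (auto simp: monomial_fun_exp positive_coefficients_def less_imp_le)
  finally have G: "?G * trop_fun g x \<le> poly_fun g x" .
  have "(poly_fun f x * trop_fun g x) * ?G \<le> (?F * trop_fun f x) * poly_fun g x"
    using mult_mono[OF F G] F_pos G_pos poly_trop_pos[OF x] by (simp add: mult_ac)
  then show "poly_fun f x * trop_fun g x / (poly_fun g x * trop_fun f x) \<le> M2 f g"
    using G_pos poly_trop_pos[OF x] by (simp add: M2_def field_simps)
qed

lemma ratio_measurable:
  shows "descend V (\<lambda>x. poly_fun f x / poly_fun g x) \<in> borel_measurable (canonical_measure V)"
    and "descend V (\<lambda>x. trop_fun f x / trop_fun g x) \<in> borel_measurable (canonical_measure V)"
    and "ratio_h V f g \<in> borel_measurable (canonical_measure V)"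
proof -
  note [measurable] = poly_fun_measurable[OF positive(1)] poly_fun_measurable[OF positive(2)]
  show "descend V (\<lambda>x. poly_fun f x / poly_fun g x) \<in> borel_measurable (canonical_measure V)"
    by (rule descend_measurable[OF fibre_constant_ratios(1)]) measurable
  show "descend V (\<lambda>x. trop_fun f x / trop_fun g x) \<in> borel_measurable (canonical_measure V)"
    by (rule descend_measurable[OF fibre_constant_ratios(2)]) measurable
  show "ratio_h V f g \<in> borel_measurable (canonical_measure V)"
    unfolding ratio_h_def by (rule descend_measurable[OF fibre_constant_ratios(3)]) measurable
qed

lemma ratio_pos:
  assumes t: "t \<in> positive_orthant"
  shows "0 < descend V (\<lambda>x. trop_fun f x / trop_fun g x) t"
    and "0 < ratio_h V f g t" "ratio_h V f g t \<le> M2 f g"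
    and "descend V (\<lambda>x. poly_fun f x / poly_fun g x) t =
      descend V (\<lambda>x. trop_fun f x / trop_fun g x) t * ratio_h V f g t"
  using poly_trop_pos[OF lift_positive] poly_ratio_le[OF lift_positive]
  by (simp_all add: ratio_h_def descend_eq[OF fibre_constant_ratios(1) t]
      descend_eq[OF fibre_constant_ratios(2) t] descend_eq[OF fibre_constant_ratios(3) t]
      less_imp_neq[symmetric])

text \<open>By \<open>trop_decay\<close> the integrand is dominated by a product of one-variable
  functions against the density \<open>\<Prod>\<^sub>j 1 / t\<^sub>j\<close>; both are written as functions on the whole
  space that vanish off the orthant, so that the integral factors.\<close>

lemma trop_ratio_integrable:
  "integrable (canonical_measure V) (descend V (\<lambda>x. trop_fun f x / trop_fun g x))"
proof (rule integrableI_nonneg)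
  let ?F = "descend V (\<lambda>x. trop_fun f x / trop_fun g x)"
  let ?O = "positive_orthant :: (real ^ 'n::{finite,linorder}) set"
  show "?F \<in> borel_measurable (canonical_measure V)"
    by (rule ratio_measurable)
  show "AE t in canonical_measure V. 0 \<le> ?F t"
    using ratio_pos(1) by (intro AE_I2) (simp add: less_imp_le)
  obtain \<epsilon> where \<epsilon>: "\<epsilon> > 0" and decay: "\<And>x. x \<in> positive_orthant \<Longrightarrow>
      trop_fun f x \<le> exp (- \<epsilon> * (\<Sum>j\<in>UNIV. \<bar>(real_matrix V *v log_vec x) $ j\<bar>)) * trop_fun g x"
    using trop_decay by blast
  have le: "?F t \<le> (\<Prod>j\<in>UNIV. exp (- \<epsilon> * \<bar>ln (t $ j)\<bar>))" if t: "t \<in> ?O" for t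
  proof -
    have "real_matrix V *v log_vec (lift t) = log_vec t"
      by (simp add: lift_def)
    then have "?F t \<le> exp (- \<epsilon> * (\<Sum>j\<in>UNIV. \<bar>ln (t $ j)\<bar>))"
      using decay[OF lift_positive, of t] poly_trop_pos[OF lift_positive, of t]
      by (simp add: descend_eq[OF fibre_constant_ratios(2) t] divide_le_eq log_vec_def)
    then show ?thesis
      by (simp add: exp_sum[symmetric] sum_distrib_left sum_negf)
  qed
  have orthant: "?O \<in> sets borel"
    using open_positive_orthant by (rule borel_open)
  have "(\<integral>\<^sup>+t. ennreal (?F t) \<partial>canonical_measure V) \<le>
      (\<integral>\<^sup>+t. ennreal (\<Prod>j\<in>UNIV. exp (- \<epsilon> * \<bar>ln (t $ j)\<bar>)) \<partial>canonical_measure V)"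
    using le by (intro nn_integral_mono) (simp add: ennreal_leI)
  also have "\<dots> = (\<integral>\<^sup>+t. ennreal (\<Prod>j\<in>UNIV. 1 / t $ j) *
      ennreal (\<Prod>j\<in>UNIV. exp (- \<epsilon> * \<bar>ln (t $ j)\<bar>)) \<partial>restrict_space lborel ?O)"
    unfolding canonical_measure_eq
    by (intro nn_integral_density measurable_restrict_space1) simp_all
  also have "\<dots> = (\<integral>\<^sup>+t. ennreal (\<Prod>j\<in>UNIV. 1 / t $ j) *
      ennreal (\<Prod>j\<in>UNIV. exp (- \<epsilon> * \<bar>ln (t $ j)\<bar>)) * indicator ?O t \<partial>lborel)"
    using orthant by (intro nn_integral_restrict_space) simp
  also have "\<dots> = (\<integral>\<^sup>+t. ennreal (\<Prod>j\<in>UNIV. indicator {0<..} (t $ j) *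
      (exp (- \<epsilon> * \<bar>ln (t $ j)\<bar>) / t $ j)) \<partial>(lborel :: (real ^ 'n::{finite,linorder}) measure))"
  proof (rule nn_integral_cong)
    fix t :: "real ^ 'n::{finite,linorder}"
    show "ennreal (\<Prod>j\<in>UNIV. 1 / t $ j) * ennreal (\<Prod>j\<in>UNIV. exp (- \<epsilon> * \<bar>ln (t $ j)\<bar>)) *
        indicator ?O t =
        ennreal (\<Prod>j\<in>UNIV. indicator {0<..} (t $ j) * (exp (- \<epsilon> * \<bar>ln (t $ j)\<bar>) / t $ j))"
    proof (cases "t \<in> ?O")
      case True
      then have pos: "0 < t $ j" for j
        by (simp add: positive_orthant_def)
      then have "0 \<le> (\<Prod>j\<in>UNIV. 1 / t $ j)"
        by (intro prod_nonneg) (simp add: less_imp_le)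
      then show ?thesis
        using True pos by (simp add: ennreal_mult'[symmetric] prod.distrib[symmetric])
    next
      case False
      then obtain j where "\<not> 0 < t $ j"
        by (auto simp: positive_orthant_def)
      then have "\<exists>j\<in>UNIV. indicator {0<..} (t $ j) * (exp (- \<epsilon> * \<bar>ln (t $ j)\<bar>) / t $ j) = 0"
        by (intro bexI[of _ j]) auto
      then have "(\<Prod>j\<in>UNIV. indicator {0<..} (t $ j) * (exp (- \<epsilon> * \<bar>ln (t $ j)\<bar>) / t $ j)) = 0"
        by (intro prod_zero) auto
      then show ?thesis
        using False by (simp only: ennreal_0 indicator_simps if_False mult_zero_right simp_thms)
    qed
  qed
  also have "\<dots> < \<infinity>"
    using \<epsilon> by (rule nn_integral_exp_log_vec_decay)
  finally show "(\<integral>\<^sup>+t. ennreal (?F t) \<partial>canonical_measure V) < \<infinity>" .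
qed

lemma poly_ratio_integrable:
  "integrable (canonical_measure V) (descend V (\<lambda>x. poly_fun f x / poly_fun g x))"
proof (rule Bochner_Integration.integrable_bound)
  let ?F = "descend V (\<lambda>x. trop_fun f x / trop_fun g x)"
  show "integrable (canonical_measure V) (\<lambda>t. ?F t * M2 f g)"
    by (intro integrable_mult_left trop_ratio_integrable)
  show "AE t in canonical_measure V.
      norm (descend V (\<lambda>x. poly_fun f x / poly_fun g x) t) \<le> norm (?F t * M2 f g)"
  proof (rule AE_I2)
    fix t
    assume "t \<in> space (canonical_measure V)"
    then have t: "t \<in> positive_orthant"
      by simp
    show "norm (descend V (\<lambda>x. poly_fun f x / poly_fun g x) t) \<le> norm (?F t * M2 f g)"
      using ratio_pos(1,2,3)[OF t] by (simp add: ratio_pos(4)[OF t] abs_mult mult_left_mono)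
  qed
qed (rule ratio_measurable)

lemma emeasure_canonical_measure_nonzero:
  "emeasure (canonical_measure V) (space (canonical_measure V)) \<noteq> 0"
proof
  let ?O = "positive_orthant :: (real ^ 'n::{finite,linorder}) set"
  let ?w = "\<lambda>t :: real ^ 'n::{finite,linorder}. ennreal (\<Prod>j\<in>UNIV. 1 / t $ j)"
  have orthant: "?O \<in> sets borel"
    using open_positive_orthant by (rule borel_open)
  have meas: "?w \<in> borel_measurable (restrict_space lborel ?O)"
    by (intro measurable_restrict_space1) simp
  assume "emeasure (canonical_measure V) (space (canonical_measure V)) = 0"
  then have "?O \<in> null_sets (density (restrict_space lborel ?O) ?w)"
    using orthant unfolding canonical_measure_eq
    by (auto simp: null_sets_def space_restrict_space sets_restrict_space)
  then have "AE t in restrict_space lborel ?O. t \<in> ?O \<longrightarrow> ?w t = 0"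
    by (simp add: null_sets_density_iff[OF meas])
  then have "AE t in lborel. t \<in> ?O \<longrightarrow> ?w t = 0"
    using orthant by (subst (asm) AE_restrict_space_iff) auto
  then have "AE t in lborel. t \<notin> ?O"
  proof (rule AE_mp, intro AE_I2 impI notI)
    fix t
    assume "t \<in> ?O \<longrightarrow> ?w t = 0" and t: "t \<in> ?O"
    then have "(\<Prod>j\<in>UNIV. 1 / t $ j) \<le> 0"
      by (simp only: ennreal_eq_0_iff)
    moreover have "0 < (\<Prod>j\<in>UNIV. 1 / t $ j)"
      using t by (intro prod_pos) (simp add: positive_orthant_def)
    ultimately show False
      by linarith
  qed
  then have "?O \<in> null_sets lborel"
    using orthant by (intro iffD2[OF AE_iff_null_sets]) simp_all
  then have "negligible ?O"
    by (simp add: negligible_iff_null_sets null_sets_completionI)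
  moreover have "exp_vec 0 \<in> ?O"
    by simp
  ultimately show False
    using open_not_negligible[OF open_positive_orthant] by blast
qed

end

section \<open>Rejection sampling\<close>

locale rejection_sampler =
  fixes P :: "'w measure" and \<mu> :: "'a measure" and h :: "'a \<Rightarrow> real" and M :: real
    and X :: "nat \<Rightarrow> 'w \<Rightarrow> 'a" and \<xi> :: "nat \<Rightarrow> 'w \<Rightarrow> real"
  assumes proposal: "prob_space \<mu>"
    and h_measurable [measurable]: "h \<in> borel_measurable \<mu>"
    and h_pos: "\<And>x. x \<in> space \<mu> \<Longrightarrow> 0 < h x"
    and h_le: "\<And>x. x \<in> space \<mu> \<Longrightarrow> h x \<le> M"
    and draws: "rejection_draws P \<mu> M X \<xi>"
begin

sublocale P: prob_space P
  using draws by (simp add: rejection_draws_def)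

sublocale \<mu>: prob_space \<mu>
  by (rule proposal)

definition draw :: "nat \<Rightarrow> 'w \<Rightarrow> 'a \<times> real" where
  "draw i \<omega> = (X i \<omega>, \<xi> i \<omega>)"

definition acceptance_region :: "'a set \<Rightarrow> ('a \<times> real) set" where
  "acceptance_region B = {z \<in> space (\<mu> \<Otimes>\<^sub>M borel). fst z \<in> B \<and> snd z < h (fst z)}"

definition first_accepted :: "nat \<Rightarrow> 'a set \<Rightarrow> 'w set" where
  "first_accepted i B = {\<omega> \<in> space P. (\<forall>j<i. \<not> accepted h X \<xi> j \<omega>) \<and>
     accepted h X \<xi> i \<omega> \<and> X i \<omega> \<in> B}"

lemma draw_indep: "P.indep_vars (\<lambda>_. \<mu> \<Otimes>\<^sub>M borel) draw UNIV"
  using draws by (simp add: rejection_draws_def draw_def[abs_def])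

lemma draw_measurable [measurable]: "draw i \<in> measurable P (\<mu> \<Otimes>\<^sub>M borel)"
  using draw_indep by (simp add: P.indep_vars_def)

lemma X_measurable [measurable]: "X i \<in> measurable P \<mu>"
  using measurable_compose[OF draw_measurable measurable_fst] by (simp add: draw_def)

lemma \<xi>_measurable [measurable]: "\<xi> i \<in> borel_measurable P"
  using measurable_compose[OF draw_measurable measurable_snd] by (simp add: draw_def)

lemma accepted_measurable [measurable]: "Measurable.pred P (accepted h X \<xi> i)"
  unfolding accepted_def[abs_def] by measurable

lemma acceptance_region_sets [measurable]:
  assumes B [measurable]: "B \<in> sets \<mu>"
  shows "acceptance_region B \<in> sets (\<mu> \<Otimes>\<^sub>M borel)"
  unfolding acceptance_region_def by measurable

lemma M_pos: "M > 0"
proof -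
  obtain x where "x \<in> space \<mu>"
    using \<mu>.not_empty by blast
  then show ?thesis
    using h_pos[of x] h_le[of x] by linarith
qed

lemma draw_in_acceptance_region:
  assumes "\<omega> \<in> space P"
  shows "draw i \<omega> \<in> acceptance_region B \<longleftrightarrow> accepted h X \<xi> i \<omega> \<and> X i \<omega> \<in> B"
  using measurable_space[OF draw_measurable assms, of i]
  by (auto simp: draw_def acceptance_region_def accepted_def)

lemma h_integrable: "integrable \<mu> h"
  using h_pos h_le by (intro \<mu>.integrable_const_bound[of _ M]) (auto intro!: AE_I2 simp: abs_of_pos)

lemma integral_h_pos: "integral\<^sup>L \<mu> h > 0"
  using normalized_measure_prob_space(1)[OF h_integrable h_pos] \<mu>.emeasure_space_1 by simp

text \<open>By Fubini: given \<open>x\<close>, the uniform variable falls below \<open>h x\<close> with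
  probability \<open>h x / M\<close>, since \<open>0 < h x \<le> M\<close>.\<close>

lemma prob_draw_accepted:
  assumes B [measurable]: "B \<in> sets \<mu>"
  shows "P.prob (draw i -` acceptance_region B \<inter> space P) = (\<integral>x. h x * indicator B x \<partial>\<mu>) / M"
proof -
  let ?U = "uniform_measure lborel {0..M}"
  interpret U: prob_space ?U
    using M_pos by (intro prob_space_uniform_measure) auto
  have height: "emeasure ?U (Pair x -` acceptance_region B) = ennreal (h x * indicator B x / M)"
    if x: "x \<in> space \<mu>" for x
  proof (cases "x \<in> B")
    case True
    then have "Pair x -` acceptance_region B = {..<h x}"
      using x by (auto simp: acceptance_region_def space_pair_measure)
    moreover have "{0..M} \<inter> {..<h x} = {0..<h x}"
      using h_le[OF x] by auto
    ultimately show ?thesis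
      using True M_pos h_pos[OF x] by (simp add: divide_ennreal)
  next
    case False
    then have "Pair x -` acceptance_region B = {}"
      by (auto simp: acceptance_region_def)
    then show ?thesis
      using False by simp
  qed
  have int: "integrable \<mu> (\<lambda>x. h x * indicator B x / M)"
    using h_integrable by (intro integrable_divide integrable_real_mult_indicator) simp_all
  have nonneg: "0 \<le> h x * indicator B x / M" if "x \<in> space \<mu>" for x
    using h_pos[OF that] M_pos by simp
  have "emeasure P (draw i -` acceptance_region B \<inter> space P) =
      emeasure (distr P (\<mu> \<Otimes>\<^sub>M borel) (draw i)) (acceptance_region B)"
    by (simp add: emeasure_distr)
  also have "\<dots> = emeasure (\<mu> \<Otimes>\<^sub>M ?U) (acceptance_region B)"
    using draws by (simp add: rejection_draws_def draw_def[abs_def])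
  also have "\<dots> = (\<integral>\<^sup>+x. emeasure ?U (Pair x -` acceptance_region B) \<partial>\<mu>)"
    by (intro U.emeasure_pair_measure_alt) (simp cong: sets_pair_measure_cong)
  also have "\<dots> = (\<integral>\<^sup>+x. ennreal (h x * indicator B x / M) \<partial>\<mu>)"
    by (intro nn_integral_cong height)
  also have "\<dots> = ennreal (\<integral>x. h x * indicator B x / M \<partial>\<mu>)"
    using int nonneg by (intro nn_integral_eq_integral AE_I2)
  finally have "ennreal (P.prob (draw i -` acceptance_region B \<inter> space P)) =
      ennreal ((\<integral>x. h x * indicator B x \<partial>\<mu>) / M)"
    by (simp add: P.emeasure_eq_measure)
  moreover have "0 \<le> (\<integral>x. h x * indicator B x \<partial>\<mu>)"
    using h_pos by (intro integral_nonneg_AE AE_I2) (simp add: less_imp_le)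
  ultimately show ?thesis
    using M_pos by (simp add: P.emeasure_eq_measure)
qed

lemma first_accepted_sets [measurable]:
  assumes B [measurable]: "B \<in> sets \<mu>"
  shows "first_accepted i B \<in> sets P"
  unfolding first_accepted_def by measurable

text \<open>The event asks that the first \<open>i\<close> draws avoid the acceptance region and that
  draw \<open>i\<close> hits its part over \<open>B\<close>, and the draws are independent.\<close>

lemma prob_first_accepted:
  assumes B [measurable]: "B \<in> sets \<mu>"
  shows "P.prob (first_accepted i B) =
    (1 - integral\<^sup>L \<mu> h / M) ^ i * ((\<integral>x. h x * indicator B x \<partial>\<mu>) / M)"
proof -
  let ?R = "space (\<mu> \<Otimes>\<^sub>M borel) - acceptance_region (space \<mu>)"
  let ?A = "\<lambda>j. if j < i then ?R else acceptance_region B"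
  have draw_space: "draw j \<omega> \<in> space (\<mu> \<Otimes>\<^sub>M borel)" if "\<omega> \<in> space P" for j \<omega>
    using measurable_space[OF draw_measurable that] .
  have X_space: "X j \<omega> \<in> space \<mu>" if "\<omega> \<in> space P" for j \<omega>
    using measurable_space[OF X_measurable that] .
  have reject: "draw j -` ?R \<inter> space P =
      space P - (draw j -` acceptance_region (space \<mu>) \<inter> space P)" for j
    using draw_space by auto
  have "P.prob (draw j -` ?R \<inter> space P) = 1 - integral\<^sup>L \<mu> h / M" for j
  proof -
    have "(\<integral>x. h x * indicator (space \<mu>) x \<partial>\<mu>) = integral\<^sup>L \<mu> h"
      by (intro Bochner_Integration.integral_cong) auto
    then show ?thesis
      unfolding reject by (subst P.prob_compl) (simp_all add: prob_draw_accepted)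
  qed
  moreover have "first_accepted i B = (\<Inter>j\<in>{..i}. draw j -` ?A j \<inter> space P)"
  proof (intro set_eqI iffI)
    fix \<omega>
    assume *: "\<omega> \<in> first_accepted i B"
    then have \<omega>: "\<omega> \<in> space P"
      by (simp add: first_accepted_def)
    have "draw j \<omega> \<in> ?A j" if "j \<le> i" for j
      using * that draw_space[OF \<omega>]
      by (cases "j = i") (auto simp: first_accepted_def draw_in_acceptance_region[OF \<omega>])
    with \<omega> show "\<omega> \<in> (\<Inter>j\<in>{..i}. draw j -` ?A j \<inter> space P)"
      by blast
  next
    fix \<omega>
    assume *: "\<omega> \<in> (\<Inter>j\<in>{..i}. draw j -` ?A j \<inter> space P)"
    then have \<omega>: "\<omega> \<in> space P"
      by auto
    have A: "draw j \<omega> \<in> ?A j" if "j \<le> i" for j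
      using * that by blast
    have "\<not> accepted h X \<xi> j \<omega>" if "j < i" for j
      using A[of j] that X_space[OF \<omega>] by (simp add: draw_in_acceptance_region[OF \<omega>])
    moreover have "accepted h X \<xi> i \<omega>" "X i \<omega> \<in> B"
      using A[of i] by (simp_all add: draw_in_acceptance_region[OF \<omega>])
    ultimately show "\<omega> \<in> first_accepted i B"
      using \<omega> by (simp add: first_accepted_def)
  qed
  moreover have "P.prob (\<Inter>j\<in>{..i}. draw j -` ?A j \<inter> space P) =
      (\<Prod>j\<in>{..i}. P.prob (draw j -` ?A j \<inter> space P))"
    by (rule P.indep_varsD[OF draw_indep]) auto
  moreover have "\<dots> = (\<Prod>j<i. P.prob (draw j -` ?R \<inter> space P)) *
      P.prob (draw i -` acceptance_region B \<inter> space P)"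
    unfolding lessThan_Suc_atMost[symmetric] prod.lessThan_Suc by simp
  ultimately show ?thesis
    by (simp add: prob_draw_accepted)
qed

text \<open>A geometric series over the round of the first acceptance; its ratio is smaller than
  \<open>1\<close> because the integral of \<open>h\<close> is positive.\<close>

lemma prob_output:
  assumes B [measurable]: "B \<in> sets \<mu>"
  shows "P.prob (\<Union>i. first_accepted i B) = (\<integral>x. h x * indicator B x \<partial>\<mu>) / integral\<^sup>L \<mu> h"
proof -
  let ?q = "integral\<^sup>L \<mu> h / M"
  have "disjoint_family (\<lambda>i. first_accepted i B)"
    by (auto simp: disjoint_family_on_def first_accepted_def) (metis linorder_neqE_nat)
  then have "(\<lambda>i. P.prob (first_accepted i B)) sums P.prob (\<Union>i. first_accepted i B)"
    by (intro P.finite_measure_UNION) auto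
  moreover have "0 < ?q"
    using integral_h_pos M_pos by simp
  moreover have "?q \<le> 1"
  proof -
    have "integral\<^sup>L \<mu> h \<le> (\<integral>x. M \<partial>\<mu>)"
      using h_integrable h_le by (intro integral_mono) auto
    then show ?thesis
      using M_pos by (simp add: \<mu>.prob_space)
  qed
  ultimately have "(\<lambda>i. (1 - ?q) ^ i * ((\<integral>x. h x * indicator B x \<partial>\<mu>) / M)) sums
      P.prob (\<Union>i. first_accepted i B)"
    by (simp add: prob_first_accepted)
  moreover have "(\<lambda>i. (1 - ?q) ^ i * ((\<integral>x. h x * indicator B x \<partial>\<mu>) / M)) sums
      (1 / (1 - (1 - ?q)) * ((\<integral>x. h x * indicator B x \<partial>\<mu>) / M))"
    using \<open>0 < ?q\<close> \<open>?q \<le> 1\<close> by (intro sums_mult2 geometric_sums) auto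
  ultimately have "P.prob (\<Union>i. first_accepted i B) =
      1 / (1 - (1 - ?q)) * ((\<integral>x. h x * indicator B x \<partial>\<mu>) / M)"
    by (rule sums_unique2)
  then show ?thesis
    using M_pos by simp
qed

theorem eventually_accepted: "AE \<omega> in P. \<exists>i. accepted h X \<xi> i \<omega>"
proof -
  have "(\<integral>x. h x * indicator (space \<mu>) x \<partial>\<mu>) = integral\<^sup>L \<mu> h"
    by (intro Bochner_Integration.integral_cong) auto
  then have "P.prob (\<Union>i. first_accepted i (space \<mu>)) = 1"
    using integral_h_pos by (simp add: prob_output)
  then have "AE \<omega> in P. \<omega> \<in> (\<Union>i. first_accepted i (space \<mu>))"
    by (subst P.AE_in_set_eq_1) auto
  then show ?thesis
    by eventually_elim (auto simp: first_accepted_def)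
qed

theorem rejection_output_measurable [measurable]: "rejection_output h X \<xi> \<in> measurable P \<mu>"
  unfolding rejection_output_def[abs_def]
  by (rule measurable_compose_countable[OF X_measurable]) measurable

theorem distr_rejection_output: "distr P \<mu> (rejection_output h X \<xi>) = normalized_measure \<mu> h"
proof (rule measure_eqI)
  fix B
  assume "B \<in> sets (distr P \<mu> (rejection_output h X \<xi>))"
  then have B [measurable]: "B \<in> sets \<mu>"
    by simp
  have "AE \<omega> in P. \<omega> \<in> rejection_output h X \<xi> -` B \<inter> space P \<longleftrightarrow> \<omega> \<in> (\<Union>i. first_accepted i B)"
    using eventually_accepted AE_space
  proof eventually_elim
    fix \<omega>
    assume acc: "\<exists>i. accepted h X \<xi> i \<omega>" and space: "\<omega> \<in> space P"
    define N where "N = (LEAST i. accepted h X \<xi> i \<omega>)"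
    have N: "accepted h X \<xi> N \<omega>" "\<And>j. j < N \<Longrightarrow> \<not> accepted h X \<xi> j \<omega>"
      unfolding N_def using acc by (auto intro: LeastI_ex dest: not_less_Least)
    have "\<omega> \<in> first_accepted i B \<longleftrightarrow> i = N \<and> X N \<omega> \<in> B" for i
      using N space by (auto simp: first_accepted_def) (metis linorder_neqE_nat)+
    then show "\<omega> \<in> rejection_output h X \<xi> -` B \<inter> space P \<longleftrightarrow> \<omega> \<in> (\<Union>i. first_accepted i B)"
      using space by (simp add: rejection_output_def N_def)
  qed
  then have "P.prob (rejection_output h X \<xi> -` B \<inter> space P) = P.prob (\<Union>i. first_accepted i B)"
    by (intro P.finite_measure_eq_AE) auto
  also have "\<dots> = (\<integral>x. h x * indicator B x \<partial>\<mu>) / integral\<^sup>L \<mu> h"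
    using B by (rule prob_output)
  finally have "emeasure (distr P \<mu> (rejection_output h X \<xi>)) B =
      ennreal ((\<integral>x. h x * indicator B x \<partial>\<mu>) / integral\<^sup>L \<mu> h)"
    by (simp add: emeasure_distr P.emeasure_eq_measure)
  moreover have "emeasure (normalized_measure \<mu> h) B =
      ennreal ((\<integral>x. h x * indicator B x \<partial>\<mu>) / integral\<^sup>L \<mu> h)"
  proof -
    have int: "integrable \<mu> (\<lambda>x. h x * indicator B x / integral\<^sup>L \<mu> h)"
      using h_integrable by (intro integrable_divide integrable_real_mult_indicator) simp_all
    have "emeasure (normalized_measure \<mu> h) B =
        (\<integral>\<^sup>+x. ennreal (1 / integral\<^sup>L \<mu> h * h x) * indicator B x \<partial>\<mu>)"
      unfolding normalized_measure_def by (intro emeasure_density) measurable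
    also have "\<dots> = (\<integral>\<^sup>+x. ennreal (h x * indicator B x / integral\<^sup>L \<mu> h) \<partial>\<mu>)"
      by (intro nn_integral_cong) (simp add: indicator_def)
    also have "\<dots> = ennreal (\<integral>x. h x * indicator B x / integral\<^sup>L \<mu> h \<partial>\<mu>)"
      using int h_pos integral_h_pos
      by (intro nn_integral_eq_integral AE_I2) (auto simp: less_imp_le)
    finally show ?thesis by simp
  qed
  ultimately show "emeasure (distr P \<mu> (rejection_output h X \<xi>)) B =
      emeasure (normalized_measure \<mu> h) B"
    by simp
qed (simp add: normalized_measure_def)

end

section \<open>Sampling from the toric density\<close>

text \<open>Normalising in two stages is the same as normalising once: the first normalising
  constant cancels.\<close>

lemma normalized_measure_normalized_measure:
  assumes G: "G \<in> borel_measurable M" "\<And>x. x \<in> space M \<Longrightarrow> 0 < G x" "integral\<^sup>L M G > 0"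
    and h: "h \<in> borel_measurable M" "\<And>x. x \<in> space M \<Longrightarrow> 0 < h x"
    and F: "\<And>x. x \<in> space M \<Longrightarrow> F x = G x * h x"
  shows "normalized_measure (normalized_measure M G) h = normalized_measure M F"
proof -
  let ?c = "integral\<^sup>L M G"
  have GF: "integral\<^sup>L (normalized_measure M G) h = integral\<^sup>L M F / ?c"
  proof -
    have "integral\<^sup>L (normalized_measure M G) h = (\<integral>x. (1 / ?c * G x) *\<^sub>R h x \<partial>M)"
      unfolding normalized_measure_def
      using G h by (intro integral_density AE_I2) (auto simp: less_imp_le)
    also have "\<dots> = (\<integral>x. F x / ?c \<partial>M)"
      by (intro Bochner_Integration.integral_cong) (simp_all add: F)
    finally show ?thesis by simp
  qed
  have "normalized_measure (normalized_measure M G) h =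
      density M (\<lambda>x. ennreal (1 / ?c * G x) *
        ennreal (1 / integral\<^sup>L (normalized_measure M G) h * h x))"
    using G(1) h(1) by (subst (1 2) normalized_measure_def) (rule density_density_eq; measurable)
  also have "\<dots> = normalized_measure M F"
    unfolding normalized_measure_def[of M F] GF
  proof (intro density_cong AE_I2)
    show "(\<lambda>x. ennreal (1 / integral\<^sup>L M F * F x)) \<in> borel_measurable M"
      using G(1) h(1) by (subst measurable_cong[where g = "\<lambda>x. ennreal (1 / integral\<^sup>L M F * (G x * h x))"])
        (simp_all add: F)
    fix x
    assume x: "x \<in> space M"
    then show "ennreal (1 / ?c * G x) * ennreal (1 / (integral\<^sup>L M F / ?c) * h x) =
        ennreal (1 / integral\<^sup>L M F * F x)"
      using G(2,3) by (subst ennreal_mult'[symmetric]) (auto simp: F less_imp_le)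
  qed (use G h in measurable)
  finally show ?thesis .
qed

theorem mainTheorem4:
  fixes \<Sigma> :: "(real ^ 'n::{finite,linorder}) set set"
    and V :: "int ^ 'k::{finite,linorder} ^ 'n::{finite,linorder}"
    and f g :: "'k cox_ring"
    and P :: "'w measure"
    and X :: "nat \<Rightarrow> 'w \<Rightarrow> real ^ 'n::{finite,linorder}"
    and \<xi> :: "nat \<Rightarrow> 'w \<Rightarrow> real"
  assumes "complete_rational_fan \<Sigma>"
    and "ray_matrix \<Sigma> V"
    and "f \<noteq> 0" and "g \<noteq> 0"
    and "positive_coefficients f" and "positive_coefficients g"
    and "\<exists>\<alpha>\<in>class_group V. homogeneous V \<alpha> f \<and> homogeneous V \<alpha> g"
    and "aff_dim (newton_polytope g) = int CARD('n)"
    and "newton_polytope f \<subseteq> rel_interior (newton_polytope g)"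
  shows "prob_space (mu_tr V f g) \<and> prob_space (mu V f g) \<and>
    (rejection_draws P (mu_tr V f g) (M2 f g) X \<xi> \<longrightarrow>
       (AE \<omega> in P. \<exists>i. accepted (ratio_h V f g) X \<xi> i \<omega>) \<and>
       rejection_output (ratio_h V f g) X \<xi> \<in> measurable P (mu V f g) \<and>
       distr P (mu V f g) (rejection_output (ratio_h V f g) X \<xi>) = mu V f g)"
proof -
  have same_degree: "\<exists>\<alpha>. homogeneous V \<alpha> f \<and> homogeneous V \<alpha> g"
    using assms(7) by blast
  interpret cox_pair V f g
    by (unfold_locales; fact)
  let ?M = "canonical_measure V"
  let ?F = "descend V (\<lambda>x. poly_fun f x / poly_fun g x)"
  let ?G = "descend V (\<lambda>x. trop_fun f x / trop_fun g x)"
  have G_pos: "0 < ?G t" and h_pos: "0 < ratio_h V f g t" and F_eq: "?F t = ?G t * ratio_h V f g t"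
    and h_le: "ratio_h V f g t \<le> M2 f g"
    if "t \<in> space ?M" for t
    using ratio_pos[of t] that by simp_all
  have F_pos: "0 < ?F t" if "t \<in> space ?M" for t
    using G_pos[OF that] h_pos[OF that] F_eq[OF that] by simp
  note tropical = normalized_measure_prob_space[OF trop_ratio_integrable G_pos
      emeasure_canonical_measure_nonzero]
  have mu_tr: "prob_space (mu_tr V f g)"
    unfolding mu_tr_def by (rule tropical(2))
  have mu: "prob_space (mu V f g)"
    unfolding mu_def
    by (rule normalized_measure_prob_space(2)[OF poly_ratio_integrable F_pos
          emeasure_canonical_measure_nonzero])
  have sets_mu: "sets (mu V f g) = sets ?M" "sets (mu_tr V f g) = sets ?M"
    and space_mu_tr: "space (mu_tr V f g) = space ?M"
    by (simp_all add: mu_def mu_tr_def normalized_measure_def)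
  have mu_eq: "normalized_measure (mu_tr V f g) (ratio_h V f g) = mu V f g"
    unfolding mu_def mu_tr_def
    using ratio_measurable(2) G_pos tropical(1) ratio_measurable(3) h_pos F_eq
    by (rule normalized_measure_normalized_measure)
  have "(AE \<omega> in P. \<exists>i. accepted (ratio_h V f g) X \<xi> i \<omega>) \<and>
       rejection_output (ratio_h V f g) X \<xi> \<in> measurable P (mu V f g) \<and>
       distr P (mu V f g) (rejection_output (ratio_h V f g) X \<xi>) = mu V f g"
    if draws: "rejection_draws P (mu_tr V f g) (M2 f g) X \<xi>"
  proof -
    interpret rejection_sampler P "mu_tr V f g" "ratio_h V f g" "M2 f g" X \<xi>
    proof (rule rejection_sampler.intro)
      show "ratio_h V f g \<in> borel_measurable (mu_tr V f g)"
        using ratio_measurable(3) by (simp add: measurable_cong_sets[OF sets_mu(2) refl])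
      show "0 < ratio_h V f g t" "ratio_h V f g t \<le> M2 f g" if "t \<in> space (mu_tr V f g)" for t
        using h_pos h_le that unfolding space_mu_tr by blast+
    qed (fact mu_tr, fact draws)
    have "distr P (mu V f g) (rejection_output (ratio_h V f g) X \<xi>) =
        distr P (mu_tr V f g) (rejection_output (ratio_h V f g) X \<xi>)"
      by (intro distr_cong) (simp_all add: sets_mu)
    also have "\<dots> = mu V f g"
      by (simp add: distr_rejection_output mu_eq)
    finally show ?thesis
      using eventually_accepted rejection_output_measurable
      by (simp add: measurable_cong_sets[OF refl sets_mu(1)] measurable_cong_sets[OF refl sets_mu(2)])
  qed
  with mu_tr mu show ?thesis
    by blast
qed

end
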